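(* Let $R$ be an integral domain and let $G$ be a subgroup of $\mathrm{Aut}(R)$ whose action on $R$ is locally finite. If $R$ is a Strong G-domain, then the fixed ring $R^G$ is also a Strong G-domain.
   Context: All rings are commutative with unity. $\mathrm{Aut}(R)$ is the group of ring automorphisms of $R$. For a subgroup $G$ of $\mathrm{Aut}(R)$, the fixed ring is $R^G=\{r\in R : \sigma(r)=r \text{ for all } \sigma\in G\}$. The action of $G$ on $R$ is locally finite if for every $r\in R$ the orbit $\{\sigma(r) : \sigma\in G\}$ is finite ($G$ itself need not be finite). An overring of an integral domain $R$ is a subring of the quotient field of $R$ containing $R$. An integral domain $R$ is a Strong G-domain if every overring of $R$ is of the form $R[1/t]$ for some nonzero $t\in R$. *)

theory Defs
  imports "HOL-Algebra.Bij" "HOL-Algebra.QuotRing" "HOL-Algebra.Generated_Rings"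
begin

section \<open>The quotient field of a domain\<close>

text \<open>
  The quotient field is built from equivalence classes of pairs
  (numerator, denominator): \<open>fraction R a b\<close> is the class of \<open>a/b\<close>.
  The lemmas below show that for a domain this yields a field, that \<open>R\<close> embeds
  into it, and that every element is a quotient of two elements of \<open>R\<close>.
\<close>

definition fraction :: "('a, 'm) ring_scheme \<Rightarrow> 'a \<Rightarrow> 'a \<Rightarrow> ('a \<times> 'a) set"
  where "fraction R a b =
    {(c, d). c \<in> carrier R \<and> d \<in> carrier R - {\<zero>\<^bsub>R\<^esub>} \<and> a \<otimes>\<^bsub>R\<^esub> d = c \<otimes>\<^bsub>R\<^esub> b}"

definition quotient_field :: "('a, 'm) ring_scheme \<Rightarrow> ('a \<times> 'a) set ring"
  where "quotient_field R =
    \<lparr>carrier = {fraction R a b | a b. a \<in> carrier R \<and> b \<in> carrier R - {\<zero>\<^bsub>R\<^esub>}},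
     mult = (\<lambda>A B. \<Union>{fraction R (a \<otimes>\<^bsub>R\<^esub> c) (b \<otimes>\<^bsub>R\<^esub> d) | a b c d.
       (a, b) \<in> A \<and> (c, d) \<in> B}),
     one = fraction R \<one>\<^bsub>R\<^esub> \<one>\<^bsub>R\<^esub>,
     zero = fraction R \<zero>\<^bsub>R\<^esub> \<one>\<^bsub>R\<^esub>,
     add = (\<lambda>A B. \<Union>{fraction R (a \<otimes>\<^bsub>R\<^esub> d \<oplus>\<^bsub>R\<^esub> c \<otimes>\<^bsub>R\<^esub> b) (b \<otimes>\<^bsub>R\<^esub> d) | a b c d.
       (a, b) \<in> A \<and> (c, d) \<in> B})\<rparr>"

definition to_quotient_field :: "('a, 'm) ring_scheme \<Rightarrow> 'a \<Rightarrow> ('a \<times> 'a) set"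
  where "to_quotient_field R a = fraction R a \<one>\<^bsub>R\<^esub>"

context domain
begin

lemma fraction_eq_iff:
  assumes "a \<in> carrier R" "b \<in> carrier R - {\<zero>}" "c \<in> carrier R" "d \<in> carrier R - {\<zero>}"
  shows "fraction R a b = fraction R c d \<longleftrightarrow> a \<otimes> d = c \<otimes> b"
proof
  assume "fraction R a b = fraction R c d"
  moreover have "(c, d) \<in> fraction R c d"
    using assms by (simp add: fraction_def)
  ultimately show "a \<otimes> d = c \<otimes> b" by (auto simp: fraction_def)
next
  assume eq: "a \<otimes> d = c \<otimes> b"
  have "a \<otimes> y = x \<otimes> b \<longleftrightarrow> c \<otimes> y = x \<otimes> d"
    if xy: "x \<in> carrier R" "y \<in> carrier R" for x y
  proof -
    have "a \<otimes> y = x \<otimes> b \<longleftrightarrow> d \<otimes> (a \<otimes> y) = d \<otimes> (x \<otimes> b)"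
      using assms xy m_lcancel[of d "a \<otimes> y" "x \<otimes> b"] by auto
    also have "d \<otimes> (a \<otimes> y) = b \<otimes> (c \<otimes> y)"
      using assms xy eq by (metis DiffD1 m_assoc m_comm)
    also have "d \<otimes> (x \<otimes> b) = b \<otimes> (x \<otimes> d)"
      using assms xy by (metis DiffD1 m_assoc m_comm m_closed)
    also have "b \<otimes> (c \<otimes> y) = b \<otimes> (x \<otimes> d) \<longleftrightarrow> c \<otimes> y = x \<otimes> d"
      using assms xy m_lcancel[of b "c \<otimes> y" "x \<otimes> d"] by auto
    finally show ?thesis .
  qed
  then show "fraction R a b = fraction R c d" by (auto simp: fraction_def)
qed

lemma fraction_refl:
  "a \<in> carrier R \<Longrightarrow> b \<in> carrier R - {\<zero>} \<Longrightarrow> (a, b) \<in> fraction R a b"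
  by (simp add: fraction_def)

lemma fraction_mem:
  assumes "(x, y) \<in> fraction R a b"
  shows "x \<in> carrier R" "y \<in> carrier R" "y \<noteq> \<zero>" "a \<otimes> y = x \<otimes> b"
  using assms by (auto simp: fraction_def)

lemma denom_mult:
  "b \<in> carrier R - {\<zero>} \<Longrightarrow> d \<in> carrier R - {\<zero>} \<Longrightarrow> b \<otimes> d \<in> carrier R - {\<zero>}"
  using integral_iff by auto

lemma fraction_mult:
  assumes "a \<in> carrier R" "b \<in> carrier R - {\<zero>}" "c \<in> carrier R" "d \<in> carrier R - {\<zero>}"
  shows "fraction R a b \<otimes>\<^bsub>quotient_field R\<^esub> fraction R c d = fraction R (a \<otimes> c) (b \<otimes> d)"
proof -
  have *: "fraction R (x \<otimes> z) (y \<otimes> w) = fraction R (a \<otimes> c) (b \<otimes> d)"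
    if m: "(x, y) \<in> fraction R a b" "(z, w) \<in> fraction R c d" for x y z w
  proof -
    note f = fraction_mem[OF m(1)] fraction_mem[OF m(2)]
    note g = fraction_mem(1,2)[OF m(1)] fraction_mem(1,2)[OF m(2)]
    have "(a \<otimes> c) \<otimes> (y \<otimes> w) = (a \<otimes> y) \<otimes> (c \<otimes> w)"
      using assms g by (simp add: m_ac)
    also have "\<dots> = (x \<otimes> b) \<otimes> (z \<otimes> d)" using f by simp
    also have "\<dots> = (x \<otimes> z) \<otimes> (b \<otimes> d)" using assms g by (simp add: m_ac)
    finally show ?thesis
      using assms f denom_mult[of y w] denom_mult[of b d] by (subst fraction_eq_iff) auto
  qed
  have "{fraction R (x \<otimes> z) (y \<otimes> w) | x y z w. (x, y) \<in> fraction R a b \<and> (z, w) \<in> fraction R c d}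
      = {fraction R (a \<otimes> c) (b \<otimes> d)}"
    using * fraction_refl[OF assms(1,2)] fraction_refl[OF assms(3,4)] by blast
  then show ?thesis
    by (simp add: quotient_field_def)
qed

lemma fraction_add:
  assumes "a \<in> carrier R" "b \<in> carrier R - {\<zero>}" "c \<in> carrier R" "d \<in> carrier R - {\<zero>}"
  shows "fraction R a b \<oplus>\<^bsub>quotient_field R\<^esub> fraction R c d =
    fraction R (a \<otimes> d \<oplus> c \<otimes> b) (b \<otimes> d)"
proof -
  have *: "fraction R (x \<otimes> w \<oplus> z \<otimes> y) (y \<otimes> w) = fraction R (a \<otimes> d \<oplus> c \<otimes> b) (b \<otimes> d)"
    if m: "(x, y) \<in> fraction R a b" "(z, w) \<in> fraction R c d" for x y z w
  proof -
    note f = fraction_mem[OF m(1)] fraction_mem[OF m(2)]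
    note g = fraction_mem(1,2)[OF m(1)] fraction_mem(1,2)[OF m(2)]
    have "(a \<otimes> d \<oplus> c \<otimes> b) \<otimes> (y \<otimes> w) = (a \<otimes> y) \<otimes> (d \<otimes> w) \<oplus> (c \<otimes> w) \<otimes> (b \<otimes> y)"
      using assms g by (simp add: m_ac l_distr r_distr)
    also have "\<dots> = (x \<otimes> b) \<otimes> (d \<otimes> w) \<oplus> (z \<otimes> d) \<otimes> (b \<otimes> y)" using f by simp
    also have "\<dots> = (x \<otimes> w \<oplus> z \<otimes> y) \<otimes> (b \<otimes> d)"
      using assms g by (simp add: m_ac l_distr r_distr)
    finally show ?thesis
      using assms f denom_mult[of y w] denom_mult[of b d] by (subst fraction_eq_iff) auto
  qed
  have "{fraction R (x \<otimes> w \<oplus> z \<otimes> y) (y \<otimes> w) | x y z w. (x, y) \<in> fraction R a b \<and> (z, w) \<in> fraction R c d}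
      = {fraction R (a \<otimes> d \<oplus> c \<otimes> b) (b \<otimes> d)}"
    using * fraction_refl[OF assms(1,2)] fraction_refl[OF assms(3,4)] by blast
  then show ?thesis
    by (simp add: quotient_field_def)
qed

lemma quotient_field_carrierE:
  assumes "A \<in> carrier (quotient_field R)"
  obtains a b where "a \<in> carrier R" "b \<in> carrier R" "b \<noteq> \<zero>" "A = fraction R a b"
  using assms by (auto simp: quotient_field_def)

lemma fraction_closed:
  "a \<in> carrier R \<Longrightarrow> b \<in> carrier R - {\<zero>} \<Longrightarrow> fraction R a b \<in> carrier (quotient_field R)"
  by (auto simp: quotient_field_def)

lemma quotient_field_zero: "\<zero>\<^bsub>quotient_field R\<^esub> = fraction R \<zero> \<one>"
  and quotient_field_one: "\<one>\<^bsub>quotient_field R\<^esub> = fraction R \<one> \<one>"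
  by (simp_all add: quotient_field_def)

lemmas quotient_field_simps =
  quotient_field_zero quotient_field_one fraction_mult fraction_add fraction_closed
  fraction_eq_iff integral_iff

theorem quotient_field_is_field: "field (quotient_field R)"
proof -
  let ?K = "quotient_field R"
  have "cring ?K"
  proof (rule cringI)
    show "abelian_group ?K"
    proof (rule abelian_groupI)
      fix A assume "A \<in> carrier ?K"
      then obtain a b where A: "a \<in> carrier R" "b \<in> carrier R" "b \<noteq> \<zero>" "A = fraction R a b"
        by (rule quotient_field_carrierE)
      have "\<ominus> a \<otimes> b \<oplus> a \<otimes> b = \<zero>"
        using A by (simp add: l_minus l_neg)
      then have "fraction R (\<ominus> a) b \<oplus>\<^bsub>?K\<^esub> A = \<zero>\<^bsub>?K\<^esub>"
        using A by (simp add: quotient_field_simps)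
      then show "\<exists>B\<in>carrier ?K. B \<oplus>\<^bsub>?K\<^esub> A = \<zero>\<^bsub>?K\<^esub>"
        using A by (intro bexI[of _ "fraction R (\<ominus> a) b"]) (auto simp: fraction_closed)
    qed ((elim quotient_field_carrierE)?; simp add: quotient_field_simps m_ac a_ac l_distr r_distr)+
    show "comm_monoid ?K"
      by (rule comm_monoidI)
        ((elim quotient_field_carrierE)?; simp add: quotient_field_simps m_ac)+
  qed ((elim quotient_field_carrierE)?; simp add: quotient_field_simps m_ac l_distr r_distr a_ac)
  then show ?thesis
  proof (rule cring.cring_fieldI2)
    show "\<zero>\<^bsub>?K\<^esub> \<noteq> \<one>\<^bsub>?K\<^esub>" by (simp add: quotient_field_simps)
  next
    fix A assume "A \<in> carrier ?K" and "A \<noteq> \<zero>\<^bsub>?K\<^esub>"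
    from \<open>A \<in> carrier ?K\<close> obtain a b
      where A: "a \<in> carrier R" "b \<in> carrier R" "b \<noteq> \<zero>" "A = fraction R a b"
      by (rule quotient_field_carrierE)
    with \<open>A \<noteq> \<zero>\<^bsub>?K\<^esub>\<close> have "a \<noteq> \<zero>" by (auto simp: quotient_field_simps)
    with A have "A \<otimes>\<^bsub>?K\<^esub> fraction R b a = \<one>\<^bsub>?K\<^esub>"
      by (simp add: quotient_field_simps m_ac)
    with A \<open>a \<noteq> \<zero>\<close> show "\<exists>B\<in>carrier ?K. A \<otimes>\<^bsub>?K\<^esub> B = \<one>\<^bsub>?K\<^esub>"
      by (intro bexI[of _ "fraction R b a"]) (auto simp: fraction_closed)
  qed
qed

lemma to_quotient_field_hom: "to_quotient_field R \<in> ring_hom R (quotient_field R)"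
  by (rule ring_hom_memI) (simp_all add: to_quotient_field_def quotient_field_simps)

lemma to_quotient_field_inj: "inj_on (to_quotient_field R) (carrier R)"
  by (rule inj_onI) (simp add: to_quotient_field_def quotient_field_simps)

lemma quotient_field_quotient:
  assumes "a \<in> carrier R" "b \<in> carrier R - {\<zero>}"
  shows "fraction R a b =
    to_quotient_field R a \<otimes>\<^bsub>quotient_field R\<^esub> inv\<^bsub>quotient_field R\<^esub> (to_quotient_field R b)"
proof -
  interpret K: field "quotient_field R" by (rule quotient_field_is_field)
  have "inv\<^bsub>quotient_field R\<^esub> (to_quotient_field R b) = fraction R \<one> b"
    using assms by (intro K.comm_inv_char) (simp_all add: to_quotient_field_def quotient_field_simps m_ac)
  then show ?thesis
    using assms by (simp add: to_quotient_field_def quotient_field_simps)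
qed

end


section \<open>Strong G-domains\<close>

definition overring :: "('a, 'm) ring_scheme \<Rightarrow> ('a \<times> 'a) set set \<Rightarrow> bool"
  where "overring R S \<longleftrightarrow>
    subring S (quotient_field R) \<and> to_quotient_field R ` carrier R \<subseteq> S"

text \<open>\<open>adjoin_inverse R t\<close> is the subring \<open>R[1/t]\<close> of the quotient field.\<close>

definition adjoin_inverse :: "('a, 'm) ring_scheme \<Rightarrow> 'a \<Rightarrow> ('a \<times> 'a) set set"
  where "adjoin_inverse R t = generate_ring (quotient_field R)
    (insert (inv\<^bsub>quotient_field R\<^esub> (to_quotient_field R t)) (to_quotient_field R ` carrier R))"

definition strong_G_domain :: "('a, 'm) ring_scheme \<Rightarrow> bool"
  where "strong_G_domain R \<longleftrightarrow> domain R \<and>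
    (\<forall>S. overring R S \<longrightarrow> (\<exists>t\<in>carrier R - {\<zero>\<^bsub>R\<^esub>}. S = adjoin_inverse R t))"


section \<open>Automorphism groups and fixed rings\<close>

text \<open>
  As for \<^const>\<open>AutoGroup\<close>, automorphisms are taken to be extensional, so that
  distinct elements of the group differ on the carrier.
\<close>

definition ring_Aut :: "('a, 'm) ring_scheme \<Rightarrow> ('a \<Rightarrow> 'a) monoid"
  where "ring_Aut R = BijGroup (carrier R) \<lparr>carrier := ring_iso R R \<inter> Bij (carrier R)\<rparr>"

lemma (in ring) group_ring_Aut: "group (ring_Aut R)"
proof -
  have "subgroup (ring_iso R R \<inter> Bij (carrier R)) (BijGroup (carrier R))"
  proof (rule group.subgroupI[OF group_BijGroup])
    show "ring_iso R R \<inter> Bij (carrier R) \<subseteq> carrier (BijGroup (carrier R))"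
      by (simp add: BijGroup_def)
    have "(\<lambda>x\<in>carrier R. x) \<in> ring_iso R R"
      by (rule ring_iso_memI) (auto simp: bij_betw_def inj_on_def)
    then show "ring_iso R R \<inter> Bij (carrier R) \<noteq> {}"
      using id_Bij by blast
  next
    fix f assume f: "f \<in> ring_iso R R \<inter> Bij (carrier R)"
    have "restrict (inv_into (carrier R) f) (carrier R) \<in> ring_iso R R"
    proof (rule ring_iso_memI)
      show "bij_betw (restrict (inv_into (carrier R) f) (carrier R)) (carrier R) (carrier R)"
        using f by (simp add: ring_iso_def bij_betw_inv_into)
      have "inv_into (carrier R) f (f \<one>) = \<one>"
        using f by (intro inv_into_f_f) (auto simp: ring_iso_def bij_betw_def)
      moreover have "f \<one> = \<one>"
        using f by (auto simp: ring_iso_def ring_hom_one)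
      ultimately show "restrict (inv_into (carrier R) f) (carrier R) \<one> = \<one>" by simp
    qed (use f in \<open>auto simp: Bij_inv_into_mem ring_iso_def ring_hom_mult ring_hom_add
          intro!: Bij_inv_into_lemma\<close>)
    then show "inv\<^bsub>BijGroup (carrier R)\<^esub> f \<in> ring_iso R R \<inter> Bij (carrier R)"
      using f by (simp add: inv_BijGroup restrict_inv_into_Bij)
  next
    fix f g
    assume f: "f \<in> ring_iso R R \<inter> Bij (carrier R)" and g: "g \<in> ring_iso R R \<inter> Bij (carrier R)"
    have "compose (carrier R) f g \<in> ring_iso R R"
      by (rule ring_iso_memI)
        (use f g in \<open>auto simp: compose_eq ring_iso_def ring_hom_mult ring_hom_add ring_hom_one
            ring_hom_closed intro: bij_betw_compose\<close>)
    then show "f \<otimes>\<^bsub>BijGroup (carrier R)\<^esub> g \<in> ring_iso R R \<inter> Bij (carrier R)"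
      using f g by (simp add: BijGroup_def compose_Bij)
  qed
  then show ?thesis
    unfolding ring_Aut_def by (rule subgroup.subgroup_is_group) (rule group_BijGroup)
qed

definition locally_finite_action :: "('a \<Rightarrow> 'a) set \<Rightarrow> ('a, 'm) ring_scheme \<Rightarrow> bool"
  where "locally_finite_action G R \<longleftrightarrow> (\<forall>r\<in>carrier R. finite {\<sigma> r | \<sigma>. \<sigma> \<in> G})"

definition fixed_ring :: "('a, 'm) ring_scheme \<Rightarrow> ('a \<Rightarrow> 'a) set \<Rightarrow> ('a, 'm) ring_scheme"
  where "fixed_ring R G = R \<lparr>carrier := {r \<in> carrier R. \<forall>\<sigma>\<in>G. \<sigma> r = r}\<rparr>"

end

theory Submission
  imports Defs "HOL-Library.Multiset"
begin

text \<open>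
  Write \<open>A\<close> for the fixed ring, \<open>L \<subseteq> K\<close> for the quotient fields of \<open>A\<close> and \<open>R\<close>, and let
  \<open>T\<close> be an overring of \<open>A\<close>. The subring \<open>RT\<close> of \<open>K\<close> generated by \<open>R\<close> and \<open>T\<close> is an
  overring of \<open>R\<close>, so \<open>RT = R[1/u]\<close> for some nonzero \<open>u\<close> in \<open>R\<close>. The idea is to replace \<open>u\<close>
  by an invariant element and then to descend from \<open>RT\<close> to \<open>T\<close>.

  Since \<open>G\<close> fixes \<open>T\<close> pointwise, its extension to \<open>K\<close> maps \<open>RT\<close> into itself, and so
  \<open>RT\<close> contains \<open>1/y\<close> for every \<open>y\<close> in the orbit of \<open>u\<close>. The orbit is finite; let \<open>s\<close> be, up to sign,
  the product of its elements, taken as the constant coefficient of the polynomial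
  \<open>\<Prod>(X - y)\<close>. All coefficients of this polynomial lie in \<open>A\<close>. Hence \<open>s\<close> lies in \<open>A\<close>,
  \<open>1/s\<close> lies in \<open>RT\<close>, and \<open>u\<close> divides \<open>s\<close>, which gives \<open>RT = R[1/s]\<close>.

  An element of \<open>T\<close> is a quotient \<open>a/b\<close> of elements of \<open>A\<close>. As it lies in \<open>R[1/s]\<close>, it equals
  \<open>r/s\<^sup>n\<close> with \<open>r\<close> in \<open>R\<close>; since \<open>a\<close>, \<open>b\<close> and \<open>s\<close> are invariant, so is \<open>r\<close>.
  Hence \<open>T \<subseteq> A[1/s]\<close> (lemma \<open>fixed_fraction_mem_adjoin_inverse\<close>).

  For the reverse inclusion \<open>1/s \<in> T\<close> is needed. The orbit polynomials show that \<open>R\<close> is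
  integral over \<open>A\<close>, so \<open>RT\<close> is generated over \<open>T\<close> by integral elements. An element of a ring that
  becomes a unit in an integral extension was a unit already: when a single integral element
  is adjoined, the extension \<open>M\<close> is a finitely generated module with \<open>M = s M\<close>, so by
  Nakayama's lemma some \<open>1 + s e\<close> with \<open>e\<close> in the base ring annihilates \<open>M\<close>, and then \<open>-e\<close> is
  the inverse of \<open>s\<close> (lemma \<open>inverse_mem_integral_extension\<close>).
\<close>

section \<open>Units in integral extensions\<close>

text \<open>
  The \<open>B\<close>-linear combinations of \<open>m 0, \<dots>, m (n - 1)\<close>. The recursion on the number of generators
  is the one on which the proof of Nakayama's lemma proceeds.
\<close>

primrec lin_span :: "('a, 'm) ring_scheme \<Rightarrow> 'a set \<Rightarrow> (nat \<Rightarrow> 'a) \<Rightarrow> nat \<Rightarrow> 'a set" where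
  "lin_span R B m 0 = {\<zero>\<^bsub>R\<^esub>}"
| "lin_span R B m (Suc n) = {x \<oplus>\<^bsub>R\<^esub> b \<otimes>\<^bsub>R\<^esub> m n | x b. x \<in> lin_span R B m n \<and> b \<in> B}"

lemma lin_span_SucI:
  "y = x \<oplus>\<^bsub>R\<^esub> b \<otimes>\<^bsub>R\<^esub> m n \<Longrightarrow> x \<in> lin_span R B m n \<Longrightarrow> b \<in> B \<Longrightarrow> y \<in> lin_span R B m (Suc n)"
  by auto

lemma lin_span_mono: "B \<subseteq> C \<Longrightarrow> lin_span R B m n \<subseteq> lin_span R C m n"
  by (induction n) auto

context cring
begin

context
  fixes B and m :: "nat \<Rightarrow> 'a"
  assumes B: "subring B R"
begin

lemma lin_span_closed:
  "(\<And>i. i < n \<Longrightarrow> m i \<in> carrier R) \<Longrightarrow> lin_span R B m n \<subseteq> carrier R"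
proof (induction n)
  case (Suc n)
  then have "lin_span R B m n \<subseteq> carrier R" "m n \<in> carrier R" by simp_all
  then show ?case using subringE(1)[OF B] by auto
qed simp

lemma lin_span_zero: "(\<And>i. i < n \<Longrightarrow> m i \<in> carrier R) \<Longrightarrow> \<zero> \<in> lin_span R B m n"
proof (induction n)
  case (Suc n)
  then have "\<zero> = \<zero> \<oplus> \<zero> \<otimes> m n" by simp
  then show ?case
    by (rule lin_span_SucI) (use Suc subringE(2)[OF B] in simp_all)
qed simp

lemma lin_span_add:
  assumes "\<And>i. i < n \<Longrightarrow> m i \<in> carrier R"
    and "x \<in> lin_span R B m n" "y \<in> lin_span R B m n"
  shows "x \<oplus> y \<in> lin_span R B m n"
  using assms
proof (induction n arbitrary: x y)
  case (Suc n)
  obtain x' b y' c where e: "x = x' \<oplus> b \<otimes> m n" "y = y' \<oplus> c \<otimes> m n"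
    and xy: "x' \<in> lin_span R B m n" "y' \<in> lin_span R B m n" and bc: "b \<in> B" "c \<in> B"
    using Suc.prems by auto
  have c: "x' \<in> carrier R" "y' \<in> carrier R" "b \<in> carrier R" "c \<in> carrier R" "m n \<in> carrier R"
    using xy bc lin_span_closed[of n] Suc.prems(1) subringE(1)[OF B] by auto
  then have "x \<oplus> y = (x' \<oplus> y') \<oplus> (b \<oplus> c) \<otimes> m n"
    unfolding e by (simp add: l_distr a_ac)
  moreover have "x' \<oplus> y' \<in> lin_span R B m n"
    using Suc.IH Suc.prems(1) xy by simp
  ultimately show ?case
    by (rule lin_span_SucI) (use bc subringE(7)[OF B] in blast)
qed simp

lemma lin_span_smult:
  assumes "\<And>i. i < n \<Longrightarrow> m i \<in> carrier R" and "b \<in> B" and "x \<in> lin_span R B m n"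
  shows "b \<otimes> x \<in> lin_span R B m n"
  using assms
proof (induction n arbitrary: x)
  case 0
  then show ?case using subringE(1)[OF B] by auto
next
  case (Suc n)
  obtain x' c where e: "x = x' \<oplus> c \<otimes> m n" and x: "x' \<in> lin_span R B m n" and bc: "c \<in> B"
    using Suc.prems by auto
  have c: "x' \<in> carrier R" "b \<in> carrier R" "c \<in> carrier R" "m n \<in> carrier R"
    using x bc lin_span_closed[of n] Suc.prems subringE(1)[OF B] by auto
  then have "b \<otimes> x = b \<otimes> x' \<oplus> (b \<otimes> c) \<otimes> m n"
    unfolding e by (simp add: r_distr m_assoc)
  moreover have "b \<otimes> x' \<in> lin_span R B m n"
    using Suc.IH Suc.prems x by simp
  ultimately show ?case
    by (rule lin_span_SucI) (use bc Suc.prems(2) subringE(6)[OF B] in blast)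
qed

lemma lin_span_gen:
  assumes "\<And>i. i < n \<Longrightarrow> m i \<in> carrier R" and "i < n"
  shows "m i \<in> lin_span R B m n"
  using assms
proof (induction n)
  case (Suc n)
  have mn: "m n \<in> carrier R" using Suc.prems by simp
  show ?case
  proof (cases "i = n")
    case True
    have "m n = \<zero> \<oplus> \<one> \<otimes> m n" using mn by simp
    then have "m n \<in> lin_span R B m (Suc n)"
      by (rule lin_span_SucI) (use lin_span_zero[of n] Suc.prems(1) subringE(3)[OF B] in auto)
    then show ?thesis using True by simp
  next
    case False
    then have "m i \<in> lin_span R B m n" using Suc by simp
    moreover have "m i = m i \<oplus> \<zero> \<otimes> m n" using Suc.prems mn by simp
    ultimately show ?thesis
      using subringE(2)[OF B] by (intro lin_span_SucI[of "m i" R "m i" \<zero>])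
  qed
qed simp

lemma lin_span_least:
  assumes "\<zero> \<in> M" and "\<And>x y. x \<in> M \<Longrightarrow> y \<in> M \<Longrightarrow> x \<oplus> y \<in> M"
    and "\<And>b i. b \<in> B \<Longrightarrow> i < n \<Longrightarrow> b \<otimes> m i \<in> M"
  shows "lin_span R B m n \<subseteq> M"
  using assms(3)
proof (induction n)
  case (Suc n)
  then have "lin_span R B m n \<subseteq> M" by simp
  then show ?case using Suc.prems assms(2) by auto
qed (use assms(1) in simp)

lemma one_plus_multiple_mult:
  assumes "s \<in> B" "d \<in> {\<one> \<oplus> s \<otimes> e | e. e \<in> B}" "d' \<in> {\<one> \<oplus> s \<otimes> e | e. e \<in> B}"
  shows "d \<otimes> d' \<in> {\<one> \<oplus> s \<otimes> e | e. e \<in> B}"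
proof -
  obtain e f where ef: "e \<in> B" "f \<in> B" "d = \<one> \<oplus> s \<otimes> e" "d' = \<one> \<oplus> s \<otimes> f"
    using assms by blast
  have c: "s \<in> carrier R" "e \<in> carrier R" "f \<in> carrier R"
    using assms(1) ef(1,2) subringE(1)[OF B] by blast+
  have "d \<otimes> d' = \<one> \<oplus> s \<otimes> (e \<oplus> f \<oplus> s \<otimes> (e \<otimes> f))"
    unfolding ef using c by (simp add: l_distr r_distr m_ac a_ac)
  moreover have "e \<oplus> f \<oplus> s \<otimes> (e \<otimes> f) \<in> B"
    using assms(1) ef(1,2) subringE(6,7)[OF B] by simp
  ultimately show ?thesis by blast
qed

text \<open>
  Nakayama's lemma in a form that needs no determinant. The factor \<open>d \<equiv> 1\<close> modulo \<open>s\<close> makes an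
  induction on the number of generators possible: the relation for the last generator is solved,
  up to a further factor \<open>d' \<equiv> 1\<close>, for that generator, and substituting the solution in the other
  relations leaves a system of the same form with factor \<open>d d'\<close>.
\<close>

lemma nakayama_annihilator:
  assumes "\<And>i. i < n \<Longrightarrow> m i \<in> carrier R" and "s \<in> B" and "d \<in> {\<one> \<oplus> s \<otimes> e | e. e \<in> B}"
    and "\<And>i. i < n \<Longrightarrow> \<exists>y\<in>lin_span R B m n. d \<otimes> m i = s \<otimes> y"
  shows "\<exists>d\<in>{\<one> \<oplus> s \<otimes> e | e. e \<in> B}. \<forall>i<n. d \<otimes> m i = \<zero>"
  using assms
proof (induction n arbitrary: d)
  case 0
  then show ?case by blast
next
  case (Suc n)
  let ?U = "{\<one> \<oplus> s \<otimes> e | e. e \<in> B}"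
  note sub = subringE(1)[OF B, THEN subsetD]
  have m: "\<And>i. i < n \<Longrightarrow> m i \<in> carrier R" using Suc.prems(1) by simp
  have mn: "m n \<in> carrier R" and s: "s \<in> carrier R"
    using Suc.prems(1,2) sub by auto
  have UB: "?U \<subseteq> B"
    using Suc.prems(2) subringE(3,6,7)[OF B] by blast
  then have Uc: "?U \<subseteq> carrier R" using sub by blast
  then have d: "d \<in> carrier R" using Suc.prems(3) by blast
  obtain z b where z: "z \<in> lin_span R B m n" and b: "b \<in> B"
    and eq: "d \<otimes> m n = s \<otimes> (z \<oplus> b \<otimes> m n)"
    using Suc.prems(4)[of n] by auto
  have zc: "z \<in> carrier R" using z lin_span_closed[of n] m by blast
  have bc: "b \<in> carrier R" using b sub by blast
  obtain c where c: "c \<in> B" "d = \<one> \<oplus> s \<otimes> c" using Suc.prems(3) by blast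
  have cc: "c \<in> carrier R" using c(1) sub by blast
  \<comment> \<open>moving the last generator to the left of its own relation changes \<open>d\<close> only by a multiple of \<open>s\<close>\<close>
  define d' where "d' = d \<oplus> \<ominus> (s \<otimes> b)"
  have "d' = \<one> \<oplus> s \<otimes> (c \<oplus> \<ominus> b)"
    unfolding d'_def c(2) using s cc bc by (simp add: r_distr r_minus a_assoc)
  moreover have "c \<oplus> \<ominus> b \<in> B" using c(1) b subringE(5,7)[OF B] by blast
  ultimately have d'U: "d' \<in> ?U" by blast
  then have d': "d' \<in> carrier R" and d'B: "d' \<in> B" using Uc UB by blast+
  have "d' \<otimes> m n = d \<otimes> m n \<oplus> \<ominus> (s \<otimes> (b \<otimes> m n))"
    unfolding d'_def using d s bc mn by (simp add: l_distr l_minus m_assoc)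
  also have "\<dots> = s \<otimes> z \<oplus> (s \<otimes> (b \<otimes> m n) \<oplus> \<ominus> (s \<otimes> (b \<otimes> m n)))"
    unfolding eq using s zc bc mn by (simp add: r_distr a_assoc)
  also have "\<dots> = s \<otimes> z" using s zc bc mn by (simp add: r_neg)
  finally have d'm: "d' \<otimes> m n = s \<otimes> z" .
  have "\<exists>y\<in>lin_span R B m n. (d \<otimes> d') \<otimes> m i = s \<otimes> y" if i: "i < n" for i
  proof -
    obtain w a where w: "w \<in> lin_span R B m n" and a: "a \<in> B"
      and e: "d \<otimes> m i = s \<otimes> (w \<oplus> a \<otimes> m n)"
      using Suc.prems(4)[of i] i by auto
    have wc: "w \<in> carrier R" using w lin_span_closed[of n] m by blast
    have ac: "a \<in> carrier R" using a sub by blast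
    have "d \<otimes> d' \<otimes> m i = d' \<otimes> (d \<otimes> m i)" using d d' m[OF i] by (simp add: m_ac)
    also have "\<dots> = s \<otimes> (d' \<otimes> w \<oplus> a \<otimes> (d' \<otimes> m n))"
      unfolding e using d' s wc ac mn by (simp add: r_distr m_ac)
    also have "\<dots> = s \<otimes> (d' \<otimes> w \<oplus> (a \<otimes> s) \<otimes> z)"
      unfolding d'm using s ac zc by (simp add: m_assoc)
    finally have "d \<otimes> d' \<otimes> m i = s \<otimes> (d' \<otimes> w \<oplus> (a \<otimes> s) \<otimes> z)" .
    moreover have "d' \<otimes> w \<oplus> (a \<otimes> s) \<otimes> z \<in> lin_span R B m n"
      using m d'B w z a Suc.prems(2) subringE(6)[OF B]
      by (intro lin_span_add lin_span_smult) auto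
    ultimately show ?thesis by blast
  qed
  then obtain f where f: "f \<in> ?U" "\<And>i. i < n \<Longrightarrow> f \<otimes> m i = \<zero>"
    using Suc.IH[OF m Suc.prems(2) one_plus_multiple_mult[OF Suc.prems(2,3) d'U]] by blast
  have fc: "f \<in> carrier R" using f(1) Uc by blast
  have "lin_span R B m n \<subseteq> {x \<in> carrier R. f \<otimes> x = \<zero>}"
  proof (rule lin_span_least)
    fix a i assume a: "a \<in> B" and i: "i < n"
    have "f \<otimes> (a \<otimes> m i) = a \<otimes> (f \<otimes> m i)" using fc sub[OF a] m[OF i] by (simp add: m_lcomm)
    then show "a \<otimes> m i \<in> {x \<in> carrier R. f \<otimes> x = \<zero>}"
      using f(2)[OF i] sub[OF a] m[OF i] by simp
  qed (use fc in \<open>auto simp: r_distr\<close>)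
  then have fz: "f \<otimes> z = \<zero>" using z by blast
  have "f \<otimes> d' \<otimes> m i = \<zero>" if "i < Suc n" for i
  proof (cases "i = n")
    case True
    have "f \<otimes> d' \<otimes> m n = f \<otimes> (d' \<otimes> m n)" using fc d' mn by (simp add: m_assoc)
    also have "\<dots> = s \<otimes> (f \<otimes> z)" unfolding d'm using fc s zc by (simp add: m_lcomm)
    finally show ?thesis using True fz s by simp
  next
    case False
    then have i: "i < n" using that by simp
    have "f \<otimes> d' \<otimes> m i = d' \<otimes> (f \<otimes> m i)"
      using fc d' m[OF i] by (simp add: m_ac)
    then show ?thesis using f(2)[OF i] d' by simp
  qed
  then show ?case using one_plus_multiple_mult[OF Suc.prems(2) f(1) d'U] by blast
qed

end

text \<open>
  The powers of \<open>r\<close> below the degree \<open>n\<close> of its integral equation span a subring \<open>M\<close>, which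
  contains \<open>r\<close> and \<open>B\<close> and hence \<open>u\<close>. So \<open>M = s (u M) \<subseteq> s M\<close>, and Nakayama's lemma yields
  \<open>e\<close> with \<open>(1 + s e) \<cdot> 1 = 0\<close>, whence \<open>u = -e\<close>.
\<close>

lemma inverse_mem_simple_integral_extension:
  assumes B: "subring B R" and r: "r \<in> carrier R"
    and int: "r [^] n \<in> lin_span R B (\<lambda>i. r [^] i) n"
    and s: "s \<in> B" and u: "u \<in> generate_ring R (insert r B)" and su: "s \<otimes> u = \<one>"
  shows "u \<in> B"
proof (cases "n = 0")
  case True
  \<comment> \<open>an integral equation of degree zero reads \<open>1 = 0\<close>\<close>
  then have "\<one> = \<zero>" using int by simp
  then have "carrier R = {\<zero>}" by (simp add: carrier_one_zero)
  moreover have "u \<in> carrier R"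
    using u generate_ring_in_carrier[of "insert r B"] r subringE(1)[OF B] by blast
  ultimately show ?thesis using subringE(2)[OF B] by simp
next
  case False
  note sub = subringE(1)[OF B, THEN subsetD]
  let ?m = "\<lambda>i::nat. r [^] i"
  let ?M = "lin_span R B ?m n"
  have m: "\<And>i. i < n \<Longrightarrow> ?m i \<in> carrier R" using r by simp
  have Mc: "?M \<subseteq> carrier R" by (rule lin_span_closed[OF B m])
  have add: "\<And>x y. x \<in> ?M \<Longrightarrow> y \<in> ?M \<Longrightarrow> x \<oplus> y \<in> ?M" by (rule lin_span_add[OF B m])
  have smult: "\<And>b x. b \<in> B \<Longrightarrow> x \<in> ?M \<Longrightarrow> b \<otimes> x \<in> ?M" by (rule lin_span_smult[OF B m])
  have zero: "\<zero> \<in> ?M" by (rule lin_span_zero[OF B m])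
  have gen: "?m i \<in> ?M" if "i < n" for i
    using lin_span_gen[OF B, where m = ?m and n = n and i = i] m that by blast
  have one: "\<one> \<in> ?M" using gen[of 0] False by simp
  have "?M \<subseteq> {x \<in> carrier R. r \<otimes> x \<in> ?M}"
  proof (rule lin_span_least[OF B])
    fix b i assume b: "b \<in> B" and i: "i < n"
    have "r [^] Suc i \<in> ?M"
      using gen[of "Suc i"] int i by (cases "Suc i = n") auto
    then have "b \<otimes> r [^] Suc i \<in> ?M" using smult b by blast
    moreover have "r \<otimes> (b \<otimes> r [^] i) = b \<otimes> r [^] Suc i"
      using r sub[OF b] by (simp add: m_ac)
    ultimately show "b \<otimes> r [^] i \<in> {x \<in> carrier R. r \<otimes> x \<in> ?M}"
      using sub[OF b] r by auto
  qed (use r zero add in \<open>auto simp: r_distr\<close>)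
  then have rM: "x \<in> ?M \<Longrightarrow> r \<otimes> x \<in> ?M" for x by blast
  have powM: "x \<in> ?M \<Longrightarrow> r [^] (i::nat) \<otimes> x \<in> ?M" for x i
  proof (induction i)
    case 0
    then show ?case using Mc by auto
  next
    case (Suc i)
    have "r [^] Suc i \<otimes> x = r \<otimes> (r [^] i \<otimes> x)" using Suc.prems Mc r by (auto simp: m_ac)
    then show ?case using Suc rM by simp
  qed
  have mult: "x \<otimes> y \<in> ?M" if x: "x \<in> ?M" and y: "y \<in> ?M" for x y
  proof -
    have "?M \<subseteq> {x \<in> carrier R. x \<otimes> y \<in> ?M}"
    proof (rule lin_span_least[OF B])
      fix b i assume b: "b \<in> B" and i: "i < n"
      have "b \<otimes> r [^] i \<otimes> y = b \<otimes> (r [^] i \<otimes> y)" using sub[OF b] r y Mc by (auto simp: m_assoc)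
      then show "b \<otimes> r [^] i \<in> {x \<in> carrier R. x \<otimes> y \<in> ?M}"
        using smult[OF b powM[OF y]] sub[OF b] r by auto
    qed (use y Mc zero add in \<open>auto simp: l_distr\<close>)
    then show ?thesis using x by blast
  qed
  have "subring ?M R"
  proof (rule subringI)
    fix x assume x: "x \<in> ?M"
    have "(\<ominus> \<one>) \<otimes> x \<in> ?M" using smult x subringE(3,5)[OF B] by blast
    then show "\<ominus> x \<in> ?M" using x Mc by (auto simp: l_minus)
  qed (use Mc one mult add in auto)
  moreover have "insert r B \<subseteq> ?M"
  proof -
    have "b \<in> ?M" if "b \<in> B" for b
      using smult[OF that one] sub[OF that] by simp
    moreover have "r \<in> ?M" using rM[OF one] r by simp
    ultimately show ?thesis by blast
  qed
  ultimately have uM: "u \<in> ?M"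
    using u generate_ring_min_subring1[of "insert r B" ?M] r sub by blast
  then have uc: "u \<in> carrier R" using Mc by blast
  have sc: "s \<in> carrier R" using s sub by blast
  have "\<exists>d\<in>{\<one> \<oplus> s \<otimes> e | e. e \<in> B}. \<forall>i<n. d \<otimes> ?m i = \<zero>"
  proof (rule nakayama_annihilator[OF B m s])
    have "\<one> = \<one> \<oplus> s \<otimes> \<zero>" using sc by simp
    then show "\<one> \<in> {\<one> \<oplus> s \<otimes> e | e. e \<in> B}" using subringE(2)[OF B] by blast
    fix i assume "i < n"
    have "\<one> \<otimes> r [^] i = s \<otimes> (r [^] i \<otimes> u)"
      using sc uc r su m_lcomm[of s "r [^] i" u] by simp
    then show "\<exists>y\<in>?M. \<one> \<otimes> r [^] i = s \<otimes> y"
      using powM[OF uM] by blast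
  qed
  then obtain e where e: "e \<in> B" "(\<one> \<oplus> s \<otimes> e) \<otimes> r [^] (0::nat) = \<zero>" using False by blast
  have ec: "e \<in> carrier R" using e sub by blast
  have "\<one> \<oplus> s \<otimes> e = \<zero>" using e sc ec by simp
  then have "u \<otimes> (\<one> \<oplus> s \<otimes> e) = \<zero>" using uc by simp
  moreover have "u \<otimes> (\<one> \<oplus> s \<otimes> e) = u \<oplus> (s \<otimes> u) \<otimes> e"
    using uc sc ec by (simp add: r_distr m_ac)
  ultimately have "u \<oplus> e = \<zero>" using su ec by simp
  then have "u = \<ominus> e" using uc ec by (simp add: sum_zero_eq_neg)
  then show ?thesis using e(1) subringE(5)[OF B] by blast
qed

lemma generate_ring_finite:
  assumes "x \<in> generate_ring R (X \<union> B)" and "X \<union> B \<subseteq> carrier R"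
  shows "\<exists>F\<subseteq>X. finite F \<and> x \<in> generate_ring R (F \<union> B)"
  using assms(1)
proof induction
  case (incl h)
  then consider "h \<in> X" | "h \<in> B" by blast
  then show ?case
  proof cases
    case 1
    then show ?thesis by (intro exI[of _ "{h}"]) (auto intro: generate_ring.incl)
  next
    case 2
    then show ?thesis by (intro exI[of _ "{}"]) (auto intro: generate_ring.incl)
  qed
next
  case (eng_add x y)
  then obtain F E where *: "F \<subseteq> X" "E \<subseteq> X" "finite F" "finite E"
    "x \<in> generate_ring R (F \<union> B)" "y \<in> generate_ring R (E \<union> B)" by blast
  have "x \<in> generate_ring R ((F \<union> E) \<union> B)" "y \<in> generate_ring R ((F \<union> E) \<union> B)"
    using * assms(2) mono_generate_ring[of "F \<union> B" "(F \<union> E) \<union> B"]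
      mono_generate_ring[of "E \<union> B" "(F \<union> E) \<union> B"] by blast+
  then show ?case
    using * by (intro exI[of _ "F \<union> E"]) (auto intro: generate_ring.eng_add)
next
  case (eng_mult x y)
  then obtain F E where *: "F \<subseteq> X" "E \<subseteq> X" "finite F" "finite E"
    "x \<in> generate_ring R (F \<union> B)" "y \<in> generate_ring R (E \<union> B)" by blast
  have "x \<in> generate_ring R ((F \<union> E) \<union> B)" "y \<in> generate_ring R ((F \<union> E) \<union> B)"
    using * assms(2) mono_generate_ring[of "F \<union> B" "(F \<union> E) \<union> B"]
      mono_generate_ring[of "E \<union> B" "(F \<union> E) \<union> B"] by blast+
  then show ?case
    using * by (intro exI[of _ "F \<union> E"]) (auto intro: generate_ring.eng_mult)
qed (auto intro: generate_ring.intros)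

text \<open>
  Only finitely many elements of \<open>X\<close> occur in an expression for \<open>u\<close>; they are removed one at a time.
\<close>

lemma inverse_mem_integral_extension:
  assumes B: "subring B R" and X: "X \<subseteq> carrier R"
    and int: "\<And>r. r \<in> X \<Longrightarrow> \<exists>n. r [^] (n::nat) \<in> lin_span R B (\<lambda>i. r [^] i) n"
    and s: "s \<in> B" and u: "u \<in> generate_ring R (X \<union> B)" and su: "s \<otimes> u = \<one>"
  shows "u \<in> B"
proof -
  have Bc: "B \<subseteq> carrier R" by (rule subringE(1)[OF B])
  obtain F where F: "finite F" "F \<subseteq> X" "u \<in> generate_ring R (F \<union> B)"
    using generate_ring_finite[OF u] X Bc by blast
  then show ?thesis
  proof (induction F)
    case empty
    then show ?case
      using generate_ring_min_subring1[OF Bc B] by auto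
  next
    case (insert r F)
    let ?C = "generate_ring R (F \<union> B)"
    have FB: "F \<union> B \<subseteq> carrier R" using insert X Bc by blast
    have rc: "r \<in> carrier R" using insert X by blast
    have C: "subring ?C R" by (rule generate_ring_is_subring[OF FB])
    have BC: "F \<union> B \<subseteq> ?C" by (auto intro: generate_ring.incl)
    obtain n where "r [^] (n::nat) \<in> lin_span R B (\<lambda>i. r [^] i) n"
      using int insert by blast
    then have n: "r [^] n \<in> lin_span R ?C (\<lambda>i. r [^] i) n"
      using lin_span_mono[of B ?C] BC by blast
    have "generate_ring R (insert r F \<union> B) \<subseteq> generate_ring R (insert r ?C)"
      using BC rc subringE(1)[OF C] by (intro mono_generate_ring) auto
    then have "u \<in> ?C"
      using inverse_mem_simple_integral_extension[OF C rc n _ _ su] insert.prems s BC by blast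
    then show ?case using insert by blast
  qed
qed

end

section \<open>Orbit polynomials and integrality\<close>

text \<open>
  Polynomials in one variable are represented by their coefficient sequences: \<open>mult_root R y\<close> is
  multiplication by \<open>X - y\<close>, and \<open>root_poly R ys\<close> is the product of the \<open>X - y\<close> for \<open>y\<close> in \<open>ys\<close>.
\<close>

definition mult_root :: "('a, 'm) ring_scheme \<Rightarrow> 'a \<Rightarrow> (nat \<Rightarrow> 'a) \<Rightarrow> nat \<Rightarrow> 'a" where
  "mult_root R y p = (\<lambda>j. case j of 0 \<Rightarrow> \<ominus>\<^bsub>R\<^esub> (y \<otimes>\<^bsub>R\<^esub> p 0) | Suc i \<Rightarrow> p i \<ominus>\<^bsub>R\<^esub> y \<otimes>\<^bsub>R\<^esub> p (Suc i))"

definition root_poly :: "('a, 'm) ring_scheme \<Rightarrow> 'a list \<Rightarrow> nat \<Rightarrow> 'a" where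
  "root_poly R ys = foldr (mult_root R) ys (\<lambda>j. if j = 0 then \<one>\<^bsub>R\<^esub> else \<zero>\<^bsub>R\<^esub>)"

lemma root_poly_Cons: "root_poly R (y # ys) = mult_root R y (root_poly R ys)"
  by (simp add: root_poly_def)

context cring
begin

lemma root_poly_closed: "set ys \<subseteq> carrier R \<Longrightarrow> root_poly R ys j \<in> carrier R"
proof (induction ys arbitrary: j)
  case (Cons y ys)
  then show ?case by (auto simp: root_poly_Cons mult_root_def split: nat.split)
qed (simp add: root_poly_def)

lemma root_poly_above_degree: "set ys \<subseteq> carrier R \<Longrightarrow> length ys < j \<Longrightarrow> root_poly R ys j = \<zero>"
proof (induction ys arbitrary: j)
  case (Cons y ys)
  then show ?case by (auto simp: root_poly_Cons mult_root_def minus_eq split: nat.split)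
qed (simp add: root_poly_def)

lemma root_poly_monic: "set ys \<subseteq> carrier R \<Longrightarrow> root_poly R ys (length ys) = \<one>"
proof (induction ys)
  case (Cons y ys)
  then show ?case
    using root_poly_above_degree[of ys "Suc (length ys)"]
    by (simp add: root_poly_Cons mult_root_def minus_eq)
qed (simp add: root_poly_def)

lemma mult_root_commute:
  assumes "y \<in> carrier R" "z \<in> carrier R" "\<And>j. p j \<in> carrier R"
  shows "mult_root R y (mult_root R z p) = mult_root R z (mult_root R y p)"
  using assms
  by (auto simp: mult_root_def fun_eq_iff minus_eq l_minus r_minus r_distr m_ac a_ac minus_add
      split: nat.split)

lemma root_poly_perm:
  assumes "mset ys = mset zs" "set ys \<subseteq> carrier R"
  shows "root_poly R ys = root_poly R zs"
proof -
  have move: "root_poly R (as @ y # bs) = mult_root R y (root_poly R (as @ bs))"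
    if "set (as @ y # bs) \<subseteq> carrier R" for as bs y
    using that
    by (induction as) (auto simp: root_poly_Cons intro!: mult_root_commute root_poly_closed)
  show ?thesis using assms
  proof (induction ys arbitrary: zs)
    case (Cons y ys)
    then have sets: "set zs = set (y # ys)" by (metis mset_eq_setD)
    then obtain as bs where zs: "zs = as @ y # bs"
      using split_list[of y zs] by auto
    with Cons.prems have "mset ys = mset (as @ bs)" by simp
    with Cons have "root_poly R ys = root_poly R (as @ bs)" by simp
    then show ?case
      using move[of as y bs] sets[symmetric] Cons.prems(2) unfolding zs
      by (simp add: root_poly_Cons del: set_append)
  qed simp
qed

text \<open>
  Evaluation of \<open>(X - y) p\<close> at \<open>x\<close>, truncated at degree \<open>n\<close>. The term \<open>p n \<otimes> x [^] Suc n\<close>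
  accounts for the truncation, and it is what makes the induction on \<open>n\<close> work for a \<open>p\<close> that need
  not vanish above \<open>n\<close>.
\<close>

lemma sum_mult_root:
  assumes "y \<in> carrier R" "x \<in> carrier R" "\<And>j. p j \<in> carrier R"
  shows "(\<Oplus>j\<in>{..n}. mult_root R y p j \<otimes> x [^] j) \<oplus> p n \<otimes> x [^] Suc n
    = (x \<ominus> y) \<otimes> (\<Oplus>j\<in>{..n}. p j \<otimes> x [^] j)"
proof (induction n)
  case 0
  then show ?case
    using assms by (simp add: mult_root_def minus_eq l_minus r_minus l_distr r_distr m_ac a_ac)
next
  case (Suc n)
  have q: "mult_root R y p j \<in> carrier R" for j
    using assms by (auto simp: mult_root_def split: nat.split)
  let ?P = "\<Oplus>j\<in>{..n}. p j \<otimes> x [^] j" and ?Q = "\<Oplus>j\<in>{..n}. mult_root R y p j \<otimes> x [^] j"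
  have PQ: "?P \<in> carrier R" "?Q \<in> carrier R" using assms q by (auto intro!: finsum_closed)
  have "(\<Oplus>j\<in>{..Suc n}. mult_root R y p j \<otimes> x [^] j) \<oplus> p (Suc n) \<otimes> x [^] Suc (Suc n)
      = (p n \<ominus> y \<otimes> p (Suc n)) \<otimes> x [^] Suc n \<oplus> ?Q \<oplus> p (Suc n) \<otimes> x [^] Suc (Suc n)"
    using assms q by (simp add: finsum_Suc mult_root_def)
  also have "\<dots> = (?Q \<oplus> p n \<otimes> x [^] Suc n) \<oplus> (x \<ominus> y) \<otimes> (p (Suc n) \<otimes> x [^] Suc n)"
    using assms PQ by (simp add: minus_eq l_minus r_minus l_distr r_distr m_ac a_ac)
  also have "\<dots> = (x \<ominus> y) \<otimes> (p (Suc n) \<otimes> x [^] Suc n \<oplus> ?P)"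
    unfolding Suc.IH using assms PQ by (simp add: r_distr a_comm)
  also have "\<dots> = (x \<ominus> y) \<otimes> (\<Oplus>j\<in>{..Suc n}. p j \<otimes> x [^] j)"
    using assms by (simp add: finsum_Suc)
  finally show ?case .
qed

lemma root_poly_root:
  assumes "set ys \<subseteq> carrier R" "x \<in> set ys"
  shows "(\<Oplus>j\<in>{..length ys}. root_poly R ys j \<otimes> x [^] j) = \<zero>"
  using assms
proof (induction ys)
  case (Cons y ys)
  have ys: "set ys \<subseteq> carrier R" and y: "y \<in> carrier R" and x: "x \<in> carrier R"
    using Cons.prems by auto
  let ?P = "\<Oplus>j\<in>{..length ys}. root_poly R ys j \<otimes> x [^] j"
  have P: "?P \<in> carrier R"
    using x root_poly_closed[OF ys] by (auto intro!: finsum_closed)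
  have "(\<Oplus>j\<in>{..length (y # ys)}. root_poly R (y # ys) j \<otimes> x [^] j)
      = (x \<ominus> y) \<otimes> (\<Oplus>j\<in>{..Suc (length ys)}. root_poly R ys j \<otimes> x [^] j)"
    using sum_mult_root[of y x "root_poly R ys" "Suc (length ys)"] x y ys root_poly_closed[OF ys]
      root_poly_above_degree[OF ys, of "Suc (length ys)"] root_poly_closed[OF Cons.prems(1)]
    by (simp add: root_poly_Cons)
  also have "\<dots> = (x \<ominus> y) \<otimes> ?P"
    using x P root_poly_closed[OF ys] root_poly_above_degree[OF ys, of "Suc (length ys)"]
    by (simp add: finsum_Suc)
  also have "\<dots> = \<zero>"
    using Cons x y ys P by (cases "x = y") (auto simp: r_neg minus_eq)
  finally show ?case .
qed simp

lemma integral_of_root_poly: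
  assumes B: "subring B R" and ys: "set ys \<subseteq> carrier R" and coeffs: "\<And>j. root_poly R ys j \<in> B"
    and x: "x \<in> set ys"
  shows "x [^] length ys \<in> lin_span R B (\<lambda>i. x [^] i) (length ys)"
proof -
  obtain n where n: "length ys = Suc n" using x by (cases ys) auto
  have xc: "x \<in> carrier R" using x ys by blast
  note sub = subringE(1)[OF B, THEN subsetD]
  let ?S = "\<lambda>k. \<Oplus>j\<in>{..k}. root_poly R ys j \<otimes> x [^] j"
  have S: "?S k \<in> lin_span R B (\<lambda>i. x [^] i) (Suc k)" for k
  proof (induction k)
    case 0
    have "?S 0 = \<zero> \<oplus> root_poly R ys 0 \<otimes> x [^] (0::nat)"
      using coeffs[of 0, THEN sub] xc by simp
    then show ?case by (rule lin_span_SucI) (use coeffs in simp_all)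
  next
    case (Suc k)
    have "?S k \<in> carrier R" using coeffs[THEN sub] xc by (auto intro!: finsum_closed)
    then have "?S (Suc k) = ?S k \<oplus> root_poly R ys (Suc k) \<otimes> x [^] Suc k"
      using coeffs[THEN sub] xc by (simp add: finsum_Suc a_comm)
    then show ?case by (rule lin_span_SucI) (use Suc coeffs in simp_all)
  qed
  have Sc: "?S n \<in> carrier R" using coeffs[THEN sub] xc by (auto intro!: finsum_closed)
  have "x [^] Suc n \<oplus> ?S n = \<zero>"
    using root_poly_root[OF ys x] root_poly_monic[OF ys] coeffs[THEN sub] xc
    unfolding n by (simp add: finsum_Suc)
  then have "x [^] Suc n = \<ominus> ?S n" using Sc xc by (simp add: sum_zero_eq_neg)
  also have "\<dots> = (\<ominus> \<one>) \<otimes> ?S n" using Sc by (simp add: l_minus)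
  finally show ?thesis
    using lin_span_smult[OF B _ _ S[of n], of "\<ominus> \<one>"] xc subringE(3,5)[OF B] unfolding n by simp
qed

end

lemma (in ring_hom_cring) hom_root_poly:
  assumes "set ys \<subseteq> carrier R"
  shows "h (root_poly R ys j) = root_poly S (map h ys) j"
  using assms
proof (induction ys arbitrary: j)
  case (Cons y ys)
  then show ?case
    using R.root_poly_closed[of ys]
    by (auto simp: root_poly_Cons mult_root_def R.minus_eq S.minus_eq split: nat.split)
qed (simp add: root_poly_def)

lemma (in ring_hom_cring) hom_lin_span:
  assumes B: "subring B R" and "\<And>i. i < n \<Longrightarrow> m i \<in> carrier R" and "x \<in> lin_span R B m n"
  shows "h x \<in> lin_span S (h ` B) (\<lambda>i. h (m i)) n"
  using assms(2,3)
proof (induction n arbitrary: x)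
  case (Suc n)
  then obtain y b where x: "x = y \<oplus> b \<otimes> m n" "y \<in> lin_span R B m n" "b \<in> B" by auto
  moreover have "y \<in> carrier R"
    using R.lin_span_closed[OF B, of n m] Suc.prems x by fastforce
  moreover have "b \<in> carrier R" using x subringE(1)[OF B] by blast
  ultimately have "h x = h y \<oplus>\<^bsub>S\<^esub> h b \<otimes>\<^bsub>S\<^esub> h (m n)" using Suc.prems(1) by simp
  then show ?case by (rule lin_span_SucI) (use x Suc in auto)
qed simp

lemma (in ring_hom_cring) hom_generate_ring:
  assumes "H \<subseteq> carrier R" and "x \<in> generate_ring R H"
  shows "h x \<in> generate_ring S (h ` H)"
  using assms(2)
proof induction
  case (incl x)
  then show ?case by (auto intro: generate_ring.incl)
qed (use R.generate_ring_in_carrier[OF assms(1)] in \<open>auto intro: generate_ring.intros\<close>)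

text \<open>
  An endomorphism that permutes the roots permutes the factors \<open>X - y\<close>, so it fixes the coefficients
  of their product.
\<close>

lemma (in cring) root_poly_invariant:
  assumes \<sigma>: "\<sigma> \<in> ring_hom R R" "inj_on \<sigma> (carrier R)"
    and ys: "distinct ys" "set ys \<subseteq> carrier R" and Y: "\<sigma> ` set ys = set ys"
  shows "\<sigma> (root_poly R ys j) = root_poly R ys j"
proof -
  interpret \<sigma>: ring_hom_cring R R \<sigma>
    using \<sigma>(1) by unfold_locales
  have "distinct (map \<sigma> ys)"
    using ys \<sigma>(2) by (auto simp: distinct_map intro: inj_on_subset)
  then have "mset (map \<sigma> ys) = mset ys"
    using ys Y by (metis set_eq_iff_mset_eq_distinct set_map)
  then show ?thesis
    using \<sigma>.hom_root_poly[OF ys(2)] root_poly_perm[of "map \<sigma> ys" ys] ys Y by auto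
qed

section \<open>Maps between quotient fields, and localizations\<close>

text \<open>
  The map \<open>x/y \<mapsto> h x / h y\<close> on quotient fields, in terms of equivalence classes of fractions.
  It serves both for the inclusion of the fixed ring, whose classes of fractions are not classes
  over \<open>R\<close> in general, and for the extension of an automorphism to the quotient field.
\<close>

definition frac_map :: "('b, 'n) ring_scheme \<Rightarrow> ('a \<Rightarrow> 'b) \<Rightarrow> ('a \<times> 'a) set \<Rightarrow> ('b \<times> 'b) set" where
  "frac_map S h X = \<Union>{fraction S (h x) (h y) | x y. (x, y) \<in> X}"

locale domain_embedding = A: domain A + R: domain R + ring_hom_cring A R h
  for A (structure) and R (structure) and h +
  assumes inj: "inj_on h (carrier A)"
begin

lemma hom_nonzero: "b \<in> carrier A - {\<zero>\<^bsub>A\<^esub>} \<Longrightarrow> h b \<in> carrier R - {\<zero>\<^bsub>R\<^esub>}"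
  using inj_onD[OF inj, of b "\<zero>\<^bsub>A\<^esub>"] by auto

lemma frac_map_fraction:
  assumes "a \<in> carrier A" "b \<in> carrier A - {\<zero>\<^bsub>A\<^esub>}"
  shows "frac_map R h (fraction A a b) = fraction R (h a) (h b)"
proof -
  have "fraction R (h x) (h y) = fraction R (h a) (h b)" if xy: "(x, y) \<in> fraction A a b" for x y
  proof -
    note f = A.fraction_mem[OF xy]
    have "h x \<otimes>\<^bsub>R\<^esub> h b = h a \<otimes>\<^bsub>R\<^esub> h y"
      using f assms by (metis DiffD1 hom_mult)
    then show ?thesis
      using f assms hom_nonzero[of b] hom_nonzero[of y] by (subst R.fraction_eq_iff) auto
  qed
  then have "{fraction R (h x) (h y) | x y. (x, y) \<in> fraction A a b} = {fraction R (h a) (h b)}"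
    using A.fraction_refl[OF assms] by blast
  then show ?thesis by (simp add: frac_map_def)
qed

lemma frac_map_to_quotient_field:
  "a \<in> carrier A \<Longrightarrow> frac_map R h (to_quotient_field A a) = to_quotient_field R (h a)"
  by (simp add: to_quotient_field_def frac_map_fraction)

lemma frac_map_hom: "frac_map R h \<in> ring_hom (quotient_field A) (quotient_field R)"
proof (rule ring_hom_memI)
  note simps = frac_map_fraction R.fraction_closed R.fraction_mult R.fraction_add
    A.fraction_mult A.fraction_add A.integral_iff R.quotient_field_one A.quotient_field_one
  fix X assume "X \<in> carrier (quotient_field A)"
  then obtain a b where X: "a \<in> carrier A" "b \<in> carrier A - {\<zero>\<^bsub>A\<^esub>}" "X = fraction A a b"
    by (auto elim!: A.quotient_field_carrierE)
  show "frac_map R h X \<in> carrier (quotient_field R)"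
    using X hom_nonzero[OF X(2)] by (simp add: simps)
  fix Y assume "Y \<in> carrier (quotient_field A)"
  then obtain c d where Y: "c \<in> carrier A" "d \<in> carrier A - {\<zero>\<^bsub>A\<^esub>}" "Y = fraction A c d"
    by (auto elim!: A.quotient_field_carrierE)
  note nz = hom_nonzero[OF X(2)] hom_nonzero[OF Y(2)]
  show "frac_map R h (X \<otimes>\<^bsub>quotient_field A\<^esub> Y)
      = frac_map R h X \<otimes>\<^bsub>quotient_field R\<^esub> frac_map R h Y"
    using X Y nz by (simp add: simps)
  show "frac_map R h (X \<oplus>\<^bsub>quotient_field A\<^esub> Y)
      = frac_map R h X \<oplus>\<^bsub>quotient_field R\<^esub> frac_map R h Y"
    using X Y nz by (simp add: simps)
next
  show "frac_map R h \<one>\<^bsub>quotient_field A\<^esub> = \<one>\<^bsub>quotient_field R\<^esub>"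
    by (simp add: frac_map_fraction A.quotient_field_one R.quotient_field_one)
qed

lemma frac_map_inj: "inj_on (frac_map R h) (carrier (quotient_field A))"
  using non_trivial_field_hom_is_inj[OF frac_map_hom A.quotient_field_is_field R.quotient_field_is_field]
  by simp

lemma frac_map_ring_hom_cring: "ring_hom_cring (quotient_field A) (quotient_field R) (frac_map R h)"
  using frac_map_hom fieldE(1)[OF A.quotient_field_is_field] fieldE(1)[OF R.quotient_field_is_field]
  by (simp add: ring_hom_cring_def ring_hom_cring_axioms_def)

end

context domain
begin

lemma pow_nonzero: "t \<in> carrier R - {\<zero>} \<Longrightarrow> t [^] (n::nat) \<in> carrier R - {\<zero>}"
  by (induction n) (auto simp: integral_iff)

lemma inv_to_quotient_field:
  assumes "t \<in> carrier R - {\<zero>}"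
  shows "inv\<^bsub>quotient_field R\<^esub> (to_quotient_field R t) = fraction R \<one> t"
proof -
  interpret K: field "quotient_field R" by (rule quotient_field_is_field)
  show ?thesis using assms
    by (intro K.comm_inv_char) (simp_all add: to_quotient_field_def quotient_field_simps m_ac)
qed

lemma to_quotient_field_closed: "to_quotient_field R ` carrier R \<subseteq> carrier (quotient_field R)"
  by (auto simp: to_quotient_field_def fraction_closed)

lemma fraction_power_mem:
  assumes S: "subring S (quotient_field R)" and R: "to_quotient_field R ` carrier R \<subseteq> S"
    and t: "t \<in> carrier R - {\<zero>}" "fraction R \<one> t \<in> S" and r: "r \<in> carrier R"
  shows "fraction R r (t [^] (n::nat)) \<in> S"
proof (induction n)
  case 0
  then show ?case using R r by (auto simp: to_quotient_field_def)
next
  case (Suc n)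
  have "fraction R r (t [^] Suc n) = fraction R r (t [^] n) \<otimes>\<^bsub>quotient_field R\<^esub> fraction R \<one> t"
    using r t(1) pow_nonzero[OF t(1), of n] by (simp add: fraction_mult)
  then show ?case using Suc t(2) subringE(6)[OF S] by simp
qed

lemma adjoin_inverse_subset_iff:
  assumes t: "t \<in> carrier R - {\<zero>}" and S: "overring R S"
  shows "adjoin_inverse R t \<subseteq> S \<longleftrightarrow> fraction R \<one> t \<in> S"
proof -
  interpret K: field "quotient_field R" by (rule quotient_field_is_field)
  have "insert (fraction R \<one> t) (to_quotient_field R ` carrier R) \<subseteq> carrier (quotient_field R)"
    using t to_quotient_field_closed by (auto simp: fraction_closed)
  from K.generate_ring_min_subring1[OF this]
  show ?thesis
    using S unfolding adjoin_inverse_def inv_to_quotient_field[OF t] overring_def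
    by (auto intro: generate_ring.incl)
qed

lemma adjoin_inverse_overring:
  assumes t: "t \<in> carrier R - {\<zero>}"
  shows "overring R (adjoin_inverse R t)"
proof -
  interpret K: field "quotient_field R" by (rule quotient_field_is_field)
  have "insert (fraction R \<one> t) (to_quotient_field R ` carrier R) \<subseteq> carrier (quotient_field R)"
    using t to_quotient_field_closed by (auto simp: fraction_closed)
  from K.generate_ring_is_subring[OF this] show ?thesis
    unfolding adjoin_inverse_def inv_to_quotient_field[OF t] overring_def
    by (auto intro: generate_ring.incl)
qed

lemma adjoin_inverseE:
  assumes t: "t \<in> carrier R - {\<zero>}" and x: "x \<in> adjoin_inverse R t"
  obtains r n where "r \<in> carrier R" "x = fraction R r (t [^] (n::nat))"
proof -
  interpret K: field "quotient_field R" by (rule quotient_field_is_field)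
  note pow = pow_nonzero[OF t]
  have "\<exists>r\<in>carrier R. \<exists>n::nat. x = fraction R r (t [^] n)"
    using x unfolding adjoin_inverse_def
  proof induction
    case one
    show ?case by (intro bexI[of _ \<one>] exI[of _ 0]) (simp_all add: quotient_field_one)
  next
    case (incl x)
    then consider "x = fraction R \<one> t" | r where "r \<in> carrier R" "x = fraction R r \<one>"
      unfolding inv_to_quotient_field[OF t] by (auto simp: to_quotient_field_def)
    then show ?case
    proof cases
      case 1
      then show ?thesis using t by (intro bexI[of _ \<one>] exI[of _ 1]) simp_all
    next
      case 2
      then show ?thesis by (intro bexI[of _ r] exI[of _ 0]) simp_all
    qed
  next
    case (a_inv x)
    then obtain r n where r: "r \<in> carrier R" "x = fraction R r (t [^] (n::nat))" by blast
    have "fraction R (\<ominus> r) (t [^] n) \<oplus>\<^bsub>quotient_field R\<^esub> x = \<zero>\<^bsub>quotient_field R\<^esub>"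
      using r(1) pow[of n] unfolding r(2) by (simp add: quotient_field_simps l_minus l_neg)
    then have "fraction R (\<ominus> r) (t [^] n) = \<ominus>\<^bsub>quotient_field R\<^esub> x"
      using r pow[of n] by (intro K.sum_zero_eq_neg) (simp_all add: fraction_closed)
    then have "\<ominus>\<^bsub>quotient_field R\<^esub> x = fraction R (\<ominus> r) (t [^] n)" ..
    then show ?case using r(1) by blast
  next
    case (eng_add x y)
    then obtain r n q m where r: "r \<in> carrier R" "x = fraction R r (t [^] (n::nat))"
      "q \<in> carrier R" "y = fraction R q (t [^] (m::nat))" by blast
    have "x \<oplus>\<^bsub>quotient_field R\<^esub> y = fraction R (r \<otimes> t [^] m \<oplus> q \<otimes> t [^] n) (t [^] (n + m))"
      using r t pow[of n] pow[of m] by (simp add: fraction_add nat_pow_mult)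
    then show ?case using r t by blast
  next
    case (eng_mult x y)
    then obtain r n q m where r: "r \<in> carrier R" "x = fraction R r (t [^] (n::nat))"
      "q \<in> carrier R" "y = fraction R q (t [^] (m::nat))" by blast
    have "x \<otimes>\<^bsub>quotient_field R\<^esub> y = fraction R (r \<otimes> q) (t [^] (n + m))"
      using r t pow[of n] pow[of m] by (simp add: fraction_mult nat_pow_mult)
    then show ?case using r t by blast
  qed
  then show ?thesis using that by blast
qed

text \<open>
  The constant coefficient of \<open>root_poly R ys\<close> is, up to sign, the product of \<open>ys\<close>.
\<close>

lemma root_poly_const_dvd:
  assumes "set ys \<subseteq> carrier R" "x \<in> set ys"
  shows "\<exists>w\<in>carrier R. root_poly R ys 0 = x \<otimes> w"
  using assms
proof (induction ys)
  case (Cons y ys)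
  then have y: "y \<in> carrier R" and ys: "set ys \<subseteq> carrier R" by auto
  have eq: "root_poly R (y # ys) 0 = y \<otimes> (\<ominus> root_poly R ys 0)"
    using y root_poly_closed[OF ys] by (simp add: root_poly_Cons mult_root_def r_minus)
  show ?case
  proof (cases "x = y")
    case True
    then show ?thesis
      using eq root_poly_closed[OF ys] by (intro bexI[of _ "\<ominus> root_poly R ys 0"]) simp_all
  next
    case False
    then obtain w where w: "w \<in> carrier R" "root_poly R ys 0 = x \<otimes> w" using Cons by auto
    have x: "x \<in> carrier R" using Cons.prems by blast
    have "root_poly R (y # ys) 0 = x \<otimes> (\<ominus> (y \<otimes> w))"
      unfolding eq w(2) using x y w(1) by (simp add: r_minus m_lcomm)
    then show ?thesis using w(1) y by (intro bexI[of _ "\<ominus> (y \<otimes> w)"]) simp_all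
  qed
qed simp

lemma inverse_root_poly_const:
  assumes S: "overring R S" and ys: "set ys \<subseteq> carrier R - {\<zero>}"
    and inv: "\<And>y. y \<in> set ys \<Longrightarrow> fraction R \<one> y \<in> S"
  shows "root_poly R ys 0 \<noteq> \<zero> \<and> fraction R \<one> (root_poly R ys 0) \<in> S"
  using ys inv
proof (induction ys)
  case Nil
  then show ?case
    using S by (auto simp: root_poly_def overring_def to_quotient_field_def)
next
  case (Cons y ys)
  let ?c = "root_poly R ys 0"
  have y: "y \<in> carrier R - {\<zero>}" and ys: "set ys \<subseteq> carrier R" using Cons.prems by auto
  have c: "?c \<in> carrier R - {\<zero>}" and ic: "fraction R \<one> ?c \<in> S"
    using Cons.IH Cons.prems root_poly_closed[OF ys, of 0] by auto
  have e: "root_poly R (y # ys) 0 = \<ominus> (y \<otimes> ?c)" by (simp add: root_poly_Cons mult_root_def)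
  have yc: "y \<otimes> ?c \<in> carrier R - {\<zero>}" by (rule denom_mult[OF y c])
  then have nz: "\<ominus> (y \<otimes> ?c) \<in> carrier R - {\<zero>}"
    by (metis DiffD1 DiffD2 DiffI a_inv_closed insertE insertI1 empty_iff minus_minus minus_zero)
  have "fraction R \<one> (\<ominus> (y \<otimes> ?c)) = fraction R (\<ominus> \<one>) (y \<otimes> ?c)"
    using nz yc fraction_eq_iff[of \<one> "\<ominus> (y \<otimes> ?c)" "\<ominus> \<one>" "y \<otimes> ?c"]
    by (simp add: l_minus r_minus)
  also have "\<dots> = to_quotient_field R (\<ominus> \<one>) \<otimes>\<^bsub>quotient_field R\<^esub>
      (fraction R \<one> y \<otimes>\<^bsub>quotient_field R\<^esub> fraction R \<one> ?c)"
    using y c yc by (simp add: to_quotient_field_def fraction_mult)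
  finally have eq: "fraction R \<one> (\<ominus> (y \<otimes> ?c)) = to_quotient_field R (\<ominus> \<one>) \<otimes>\<^bsub>quotient_field R\<^esub>
      (fraction R \<one> y \<otimes>\<^bsub>quotient_field R\<^esub> fraction R \<one> ?c)" .
  have sub: "subring S (quotient_field R)" and R: "to_quotient_field R ` carrier R \<subseteq> S"
    using S by (auto simp: overring_def)
  have "to_quotient_field R (\<ominus> \<one>) \<in> S" using R by (rule subsetD) simp
  moreover have "fraction R \<one> y \<in> S" using Cons.prems(2) by simp
  ultimately have "fraction R \<one> (\<ominus> (y \<otimes> ?c)) \<in> S"
    unfolding eq by (intro subringE(6)[OF sub] ic)
  then show ?case using nz unfolding e by simp
qed

end

section \<open>The fixed ring and its overrings\<close>

lemma fixed_ring_eq: "fixed_ring R G = R\<lparr>carrier := carrier (fixed_ring R G)\<rparr>"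
  by (simp add: fixed_ring_def)

lemma mem_fixed_ring_iff:
  "r \<in> carrier (fixed_ring R G) \<longleftrightarrow> r \<in> carrier R \<and> (\<forall>\<sigma>\<in>G. \<sigma> r = r)"
  by (simp add: fixed_ring_def)

lemma fixed_ring_fixed: "r \<in> carrier (fixed_ring R G) \<Longrightarrow> \<sigma> \<in> G \<Longrightarrow> \<sigma> r = r"
  unfolding mem_fixed_ring_iff by blast

lemma fixed_ring_simps:
  "\<one>\<^bsub>fixed_ring R G\<^esub> = \<one>\<^bsub>R\<^esub>" "\<zero>\<^bsub>fixed_ring R G\<^esub> = \<zero>\<^bsub>R\<^esub>"
  "x \<otimes>\<^bsub>fixed_ring R G\<^esub> y = x \<otimes>\<^bsub>R\<^esub> y" "x \<oplus>\<^bsub>fixed_ring R G\<^esub> y = x \<oplus>\<^bsub>R\<^esub> y"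
  "x [^]\<^bsub>fixed_ring R G\<^esub> (n::nat) = x [^]\<^bsub>R\<^esub> n"
  by (simp_all add: fixed_ring_def nat_pow_def)

locale domain_aut_action = domain R for R (structure) +
  fixes G
  assumes G: "subgroup G (ring_Aut R)"
begin

lemma aut_hom: "\<sigma> \<in> G \<Longrightarrow> \<sigma> \<in> ring_hom R R"
  and aut_inj: "\<sigma> \<in> G \<Longrightarrow> inj_on \<sigma> (carrier R)"
  using subgroup.mem_carrier[OF G] by (auto simp: ring_Aut_def ring_iso_def bij_betw_def)

lemma aut_ring_hom_cring: "\<sigma> \<in> G \<Longrightarrow> ring_hom_cring R R \<sigma>"
  using aut_hom by (simp add: ring_hom_cring_def ring_hom_cring_axioms_def is_cring)

lemma aut_domain_embedding: "\<sigma> \<in> G \<Longrightarrow> domain_embedding R R \<sigma>"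
  using aut_ring_hom_cring aut_inj
  by (simp add: domain_embedding_def domain_embedding_axioms_def domain_axioms)

lemma orbit_closed: "r \<in> carrier R \<Longrightarrow> {\<tau> r | \<tau>. \<tau> \<in> G} \<subseteq> carrier R"
  using ring_hom_closed[OF aut_hom] by blast

lemma self_mem_orbit:
  assumes r: "r \<in> carrier R"
  shows "r \<in> {\<tau> r | \<tau>. \<tau> \<in> G}"
proof -
  have "\<one>\<^bsub>ring_Aut R\<^esub> r = r" using r by (simp add: ring_Aut_def BijGroup_def)
  then show ?thesis
    using subgroup.one_closed[OF G] by (intro CollectI exI[of _ "\<one>\<^bsub>ring_Aut R\<^esub>"]) simp
qed

lemma aut_orbit_image:
  assumes \<sigma>: "\<sigma> \<in> G" and r: "r \<in> carrier R" and fin: "finite {\<tau> r | \<tau>. \<tau> \<in> G}"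
  shows "\<sigma> ` {\<tau> r | \<tau>. \<tau> \<in> G} = {\<tau> r | \<tau>. \<tau> \<in> G}"
proof (rule card_subset_eq[OF fin])
  have "\<sigma> (\<tau> r) \<in> {\<tau> r | \<tau>. \<tau> \<in> G}" if \<tau>: "\<tau> \<in> G" for \<tau>
  proof -
    have "\<sigma> \<otimes>\<^bsub>ring_Aut R\<^esub> \<tau> = compose (carrier R) \<sigma> \<tau>"
      using subgroup.mem_carrier[OF G \<sigma>] subgroup.mem_carrier[OF G \<tau>]
      by (simp add: ring_Aut_def BijGroup_def)
    then have "\<sigma> (\<tau> r) = (\<sigma> \<otimes>\<^bsub>ring_Aut R\<^esub> \<tau>) r" using r by (simp add: compose_eq)
    then show ?thesis using subgroup.m_closed[OF G \<sigma> \<tau>] by blast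
  qed
  then show "\<sigma> ` {\<tau> r | \<tau>. \<tau> \<in> G} \<subseteq> {\<tau> r | \<tau>. \<tau> \<in> G}" by blast
  show "card (\<sigma> ` {\<tau> r | \<tau>. \<tau> \<in> G}) = card {\<tau> r | \<tau>. \<tau> \<in> G}"
    by (rule card_image[OF inj_on_subset[OF aut_inj[OF \<sigma>] orbit_closed[OF r]]])
qed

lemma fixed_ring_subring: "subring (carrier (fixed_ring R G)) R"
proof -
  have "subring {x \<in> carrier R. \<sigma> x = x} R" if "\<sigma> \<in> G" for \<sigma>
  proof -
    interpret ring_hom_cring R R \<sigma> by (rule aut_ring_hom_cring[OF that])
    show ?thesis by (rule subringI) auto
  qed
  moreover have "carrier (fixed_ring R G) = \<Inter>((\<lambda>\<sigma>. {x \<in> carrier R. \<sigma> x = x}) ` G)"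
    using subgroup.one_closed[OF G] by (auto simp: fixed_ring_def)
  ultimately show ?thesis
    using subring_Inter[of "(\<lambda>\<sigma>. {x \<in> carrier R. \<sigma> x = x}) ` G"] subgroup.one_closed[OF G] by auto
qed

lemma fixed_ring_domain: "domain (fixed_ring R G)"
  using subring_is_domain[OF fixed_ring_subring] fixed_ring_eq[of R G] by simp

lemma fixed_ring_embedding: "domain_embedding (fixed_ring R G) R (\<lambda>x. x)"
proof -
  interpret A: domain "fixed_ring R G" by (rule fixed_ring_domain)
  have "(\<lambda>x. x) \<in> ring_hom (fixed_ring R G) R"
    using subringE(1)[OF fixed_ring_subring] by (auto intro!: ring_hom_memI simp: fixed_ring_simps)
  then show ?thesis by unfold_locales auto
qed

text \<open>
  Here \<open>ys\<close> lists the orbit of \<open>r\<close> without repetition, and each automorphism in \<open>G\<close> permutes it.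
\<close>

lemma orbit_poly_fixed:
  assumes r: "r \<in> carrier R" and ys: "distinct ys" "set ys = {\<tau> r | \<tau>. \<tau> \<in> G}"
  shows "root_poly R ys j \<in> carrier (fixed_ring R G)"
proof -
  have c: "set ys \<subseteq> carrier R" using orbit_closed[OF r] ys(2) by simp
  have "\<sigma> (root_poly R ys j) = root_poly R ys j" if \<sigma>: "\<sigma> \<in> G" for \<sigma>
  proof (rule root_poly_invariant[OF aut_hom[OF \<sigma>] aut_inj[OF \<sigma>] ys(1) c])
    show "\<sigma> ` set ys = set ys"
      unfolding ys(2) by (rule aut_orbit_image[OF \<sigma> r]) (use ys(2) List.finite_set[of ys] in simp)
  qed
  then show ?thesis
    using root_poly_closed[OF c] by (simp add: mem_fixed_ring_iff)
qed

lemma integral_over_fixed_ring: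
  assumes r: "r \<in> carrier R" and fin: "finite {\<tau> r | \<tau>. \<tau> \<in> G}"
  shows "\<exists>n. r [^] (n::nat) \<in> lin_span R (carrier (fixed_ring R G)) (\<lambda>i. r [^] i) n"
proof -
  obtain ys where ys: "distinct ys" "set ys = {\<tau> r | \<tau>. \<tau> \<in> G}"
    using finite_distinct_list[OF fin] by blast
  have "set ys \<subseteq> carrier R" using orbit_closed[OF r] ys(2) by simp
  from integral_of_root_poly[OF fixed_ring_subring this orbit_poly_fixed[OF r ys]]
  show ?thesis using self_mem_orbit[OF r] ys(2) by blast
qed

text \<open>
  The compositum \<open>RT\<close> inside the quotient field of \<open>R\<close>. The overring \<open>T\<close> of the fixed ring consists of
  fractions of the fixed ring and has to be transported by \<open>frac_map\<close> first.
\<close>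

definition extended_overring :: "('a \<times> 'a) set set \<Rightarrow> ('a \<times> 'a) set set" where
  "extended_overring T = generate_ring (quotient_field R)
     (to_quotient_field R ` carrier R \<union> frac_map R (\<lambda>x. x) ` T)"

context
  fixes T
  assumes T: "overring (fixed_ring R G) T"
begin

interpretation A: domain "fixed_ring R G" by (rule fixed_ring_domain)
interpretation K: field "quotient_field R" by (rule quotient_field_is_field)
interpretation E: domain_embedding "fixed_ring R G" R "\<lambda>x. x" by (rule fixed_ring_embedding)
interpretation \<phi>: ring_hom_cring "quotient_field (fixed_ring R G)" "quotient_field R" "frac_map R (\<lambda>x. x)"
  by (rule E.frac_map_ring_hom_cring)

lemma overring_subring: "subring T (quotient_field (fixed_ring R G))"
  and overring_contains: "to_quotient_field (fixed_ring R G) ` carrier (fixed_ring R G) \<subseteq> T"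
  using T by (auto simp: overring_def)

lemma overring_fractionE:
  assumes "x \<in> T"
  obtains a b where "a \<in> carrier (fixed_ring R G)" "b \<in> carrier (fixed_ring R G) - {\<zero>}"
    "x = fraction (fixed_ring R G) a b" "frac_map R (\<lambda>x. x) x = fraction R a b"
proof -
  have "x \<in> carrier (quotient_field (fixed_ring R G))"
    using assms subringE(1)[OF overring_subring] by blast
  then obtain a b where ab: "a \<in> carrier (fixed_ring R G)"
    "b \<in> carrier (fixed_ring R G) - {\<zero>\<^bsub>fixed_ring R G\<^esub>}" "x = fraction (fixed_ring R G) a b"
    by (auto elim!: A.quotient_field_carrierE)
  then show ?thesis
    using that[OF ab(1) _ ab(3)] E.frac_map_fraction[OF ab(1,2)] by (simp add: fixed_ring_simps)
qed

lemma image_subring: "subring (frac_map R (\<lambda>x. x) ` T) (quotient_field R)"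
  by (rule \<phi>.ring.img_is_subring[OF overring_subring])

lemma image_contains_fixed_ring:
  "to_quotient_field R ` carrier (fixed_ring R G) \<subseteq> frac_map R (\<lambda>x. x) ` T"
proof
  fix x assume "x \<in> to_quotient_field R ` carrier (fixed_ring R G)"
  then obtain a where a: "a \<in> carrier (fixed_ring R G)" "x = to_quotient_field R a" by blast
  have "to_quotient_field (fixed_ring R G) a \<in> T" using overring_contains a(1) by blast
  then show "x \<in> frac_map R (\<lambda>x. x) ` T"
    unfolding a(2) E.frac_map_to_quotient_field[OF a(1), symmetric] by (rule imageI)
qed

lemma extension_generators_closed:
  "to_quotient_field R ` carrier R \<union> frac_map R (\<lambda>x. x) ` T \<subseteq> carrier (quotient_field R)"
  using to_quotient_field_closed subringE(1)[OF image_subring] by blast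

lemma extended_overring_overring: "overring R (extended_overring T)"
  unfolding overring_def extended_overring_def
  using K.generate_ring_is_subring[OF extension_generators_closed]
  by (auto intro: generate_ring.incl)

lemma overring_subset_extended: "frac_map R (\<lambda>x. x) ` T \<subseteq> extended_overring T"
  unfolding extended_overring_def by (auto intro: generate_ring.incl)

text \<open>
  The generators of \<open>RT\<close> are mapped to generators: an automorphism in \<open>G\<close> permutes the elements of
  \<open>R\<close> and fixes every quotient of two invariant elements.
\<close>

lemma extended_overring_invariant:
  assumes \<sigma>: "\<sigma> \<in> G" and x: "x \<in> extended_overring T"
  shows "frac_map R \<sigma> x \<in> extended_overring T"
proof -
  interpret \<sigma>: domain_embedding R R \<sigma> by (rule aut_domain_embedding[OF \<sigma>])
  interpret \<sigma>': ring_hom_cring "quotient_field R" "quotient_field R" "frac_map R \<sigma>"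
    by (rule \<sigma>.frac_map_ring_hom_cring)
  let ?H = "to_quotient_field R ` carrier R \<union> frac_map R (\<lambda>x. x) ` T"
  have "frac_map R \<sigma> y \<in> ?H" if "y \<in> ?H" for y
    using that
  proof
    assume "y \<in> to_quotient_field R ` carrier R"
    then obtain r where r: "r \<in> carrier R" "y = to_quotient_field R r" by blast
    have "frac_map R \<sigma> y = to_quotient_field R (\<sigma> r)"
      unfolding r(2) by (rule \<sigma>.frac_map_to_quotient_field[OF r(1)])
    moreover have "\<sigma> r \<in> carrier R" by (rule \<sigma>.hom_closed[OF r(1)])
    ultimately show ?thesis by blast
  next
    assume y: "y \<in> frac_map R (\<lambda>x. x) ` T"
    then obtain t where t: "t \<in> T" "y = frac_map R (\<lambda>x. x) t" by blast
    from t(1) obtain a b where ab: "a \<in> carrier (fixed_ring R G)" "b \<in> carrier (fixed_ring R G) - {\<zero>}"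
      and "frac_map R (\<lambda>x. x) t = fraction R a b"
      by (rule overring_fractionE)
    then have ya: "y = fraction R a b" using t(2) by simp
    have "\<sigma> a = a" "\<sigma> b = b" using fixed_ring_fixed[OF _ \<sigma>] ab(1,2) by blast+
    moreover have "a \<in> carrier R" "b \<in> carrier R - {\<zero>}"
      using ab(1,2) subringE(1)[OF fixed_ring_subring] by blast+
    ultimately have "frac_map R \<sigma> y = y" unfolding ya by (simp only: \<sigma>.frac_map_fraction)
    then show ?thesis using y by simp
  qed
  then have "frac_map R \<sigma> ` ?H \<subseteq> ?H" by blast
  then have "generate_ring (quotient_field R) (frac_map R \<sigma> ` ?H) \<subseteq> extended_overring T"
    unfolding extended_overring_def using extension_generators_closed by (rule K.mono_generate_ring)
  moreover have "frac_map R \<sigma> x \<in> generate_ring (quotient_field R) (frac_map R \<sigma> ` ?H)"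
    using \<sigma>'.hom_generate_ring[OF extension_generators_closed] x unfolding extended_overring_def .
  ultimately show ?thesis by blast
qed

text \<open>
  The extension \<open>RT\<close> of \<open>T\<close> is generated by elements integral over the fixed ring, so an element
  of \<open>T\<close> that is invertible in \<open>RT\<close> is invertible in \<open>T\<close>.
\<close>

lemma inverse_mem_overring:
  assumes lf: "locally_finite_action G R"
    and s: "s \<in> carrier (fixed_ring R G) - {\<zero>}" and inv: "fraction R \<one> s \<in> extended_overring T"
  shows "fraction (fixed_ring R G) \<one> s \<in> T"
proof -
  interpret \<iota>: ring_hom_cring R "quotient_field R" "to_quotient_field R"
    using to_quotient_field_hom by unfold_locales
  have sR: "s \<in> carrier R - {\<zero>}" using s subringE(1)[OF fixed_ring_subring] by blast
  have "fraction R \<one> s \<in> frac_map R (\<lambda>x. x) ` T"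
  proof (rule K.inverse_mem_integral_extension[OF image_subring to_quotient_field_closed _ _
        inv[unfolded extended_overring_def]])
    show "to_quotient_field R s \<in> frac_map R (\<lambda>x. x) ` T"
      using image_contains_fixed_ring s by blast
    show "to_quotient_field R s \<otimes>\<^bsub>quotient_field R\<^esub> fraction R \<one> s = \<one>\<^bsub>quotient_field R\<^esub>"
      using sR by (simp add: to_quotient_field_def quotient_field_simps)
    fix x assume "x \<in> to_quotient_field R ` carrier R"
    then obtain r where r: "r \<in> carrier R" "x = to_quotient_field R r" by blast
    have pow: "to_quotient_field R (r [^] (i::nat)) = x [^]\<^bsub>quotient_field R\<^esub> i" for i
      unfolding r(2) by (rule \<iota>.ring.hom_nat_pow[OF r(1)])
    obtain n where "r [^] (n::nat) \<in> lin_span R (carrier (fixed_ring R G)) (\<lambda>i. r [^] i) n"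
      using integral_over_fixed_ring[OF r(1)] lf r(1) unfolding locally_finite_action_def by blast
    from \<iota>.hom_lin_span[OF fixed_ring_subring nat_pow_closed[OF r(1)] this]
    have "x [^]\<^bsub>quotient_field R\<^esub> n \<in> lin_span (quotient_field R)
        (to_quotient_field R ` carrier (fixed_ring R G)) (\<lambda>i. x [^]\<^bsub>quotient_field R\<^esub> i) n"
      unfolding pow .
    from subsetD[OF lin_span_mono[OF image_contains_fixed_ring] this]
    show "\<exists>n. x [^]\<^bsub>quotient_field R\<^esub> (n::nat) \<in> lin_span (quotient_field R)
        (frac_map R (\<lambda>x. x) ` T) (\<lambda>i. x [^]\<^bsub>quotient_field R\<^esub> i) n"
      by (rule exI)
  qed
  then obtain t where t: "fraction R \<one> s = frac_map R (\<lambda>x. x) t" "t \<in> T" by (rule imageE)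
  have one: "\<one> \<in> carrier (fixed_ring R G)" by (rule subringE(3)[OF fixed_ring_subring])
  have s': "s \<in> carrier (fixed_ring R G) - {\<zero>\<^bsub>fixed_ring R G\<^esub>}"
    using s by (simp add: fixed_ring_simps)
  have "frac_map R (\<lambda>x. x) t = frac_map R (\<lambda>x. x) (fraction (fixed_ring R G) \<one> s)"
    unfolding E.frac_map_fraction[OF one s'] by (rule t(1)[symmetric])
  moreover have "t \<in> carrier (quotient_field (fixed_ring R G))"
    using t(2) subringE(1)[OF overring_subring] by blast
  ultimately have "t = fraction (fixed_ring R G) \<one> s"
    using A.fraction_closed[OF one s'] by (rule inj_onD[OF E.frac_map_inj])
  then show ?thesis using t(2) by simp
qed

text \<open>
  If \<open>a/b = r/s\<^sup>n\<close> with \<open>a\<close>, \<open>b\<close>, \<open>s\<close> invariant, then applying \<open>\<sigma>\<close> to \<open>a s\<^sup>n = r b\<close> and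
  cancelling \<open>b\<close> shows that \<open>r\<close> is invariant.
\<close>

lemma fixed_fraction_mem_adjoin_inverse:
  assumes x: "x \<in> T" and s: "s \<in> carrier (fixed_ring R G) - {\<zero>}"
    and mem: "frac_map R (\<lambda>x. x) x \<in> adjoin_inverse R s"
  shows "x \<in> adjoin_inverse (fixed_ring R G) s"
proof -
  let ?A = "fixed_ring R G"
  obtain a b where ab: "a \<in> carrier ?A" "b \<in> carrier ?A - {\<zero>}"
    and xA: "x = fraction ?A a b" and xR: "frac_map R (\<lambda>x. x) x = fraction R a b"
    using overring_fractionE[OF x] .
  have AR: "carrier ?A \<subseteq> carrier R" by (rule subringE(1)[OF fixed_ring_subring])
  have aR: "a \<in> carrier R" and bR: "b \<in> carrier R - {\<zero>}" and sR: "s \<in> carrier R - {\<zero>}"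
    using ab s AR by auto
  have s': "s \<in> carrier ?A - {\<zero>\<^bsub>?A\<^esub>}" and b': "b \<in> carrier ?A - {\<zero>\<^bsub>?A\<^esub>}"
    using s ab(2) by (simp_all add: fixed_ring_simps)
  have snA: "s [^] n \<in> carrier ?A - {\<zero>\<^bsub>?A\<^esub>}" for n :: nat
    using A.pow_nonzero[OF s', of n] by (simp add: fixed_ring_simps)
  obtain r n where r: "r \<in> carrier R" "fraction R a b = fraction R r (s [^] (n::nat))"
    using adjoin_inverseE[OF sR mem] xR by metis
  then have rb: "a \<otimes> s [^] n = r \<otimes> b"
    using fraction_eq_iff aR bR pow_nonzero[OF sR] by blast
  have "\<sigma> r = r" if \<sigma>: "\<sigma> \<in> G" for \<sigma>
  proof -
    interpret \<sigma>: ring_hom_cring R R \<sigma> by (rule aut_ring_hom_cring[OF \<sigma>])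
    have "a \<otimes> s [^] n \<in> carrier ?A" using ab(1) snA[of n] subringE(6)[OF fixed_ring_subring] by blast
    then have "\<sigma> (r \<otimes> b) = r \<otimes> b" unfolding rb by (rule fixed_ring_fixed[OF _ \<sigma>])
    moreover have "\<sigma> b = b" using fixed_ring_fixed[OF _ \<sigma>] ab(2) by blast
    ultimately have "\<sigma> r \<otimes> b = r \<otimes> b" using r(1) bR by simp
    then show ?thesis using r(1) bR m_rcancel[of b "\<sigma> r" r] by simp
  qed
  then have rA: "r \<in> carrier ?A" using r(1) by (simp add: mem_fixed_ring_iff)
  have "x = fraction ?A r (s [^]\<^bsub>?A\<^esub> n)"
    unfolding xA fixed_ring_simps A.fraction_eq_iff[OF ab(1) b' rA snA] by (rule rb)
  moreover have ov: "overring ?A (adjoin_inverse ?A s)" by (rule A.adjoin_inverse_overring[OF s'])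
  then have "fraction ?A r (s [^]\<^bsub>?A\<^esub> n) \<in> adjoin_inverse ?A s"
    using A.adjoin_inverse_subset_iff[OF s' ov]
    by (intro A.fraction_power_mem[OF _ _ s' _ rA]) (auto simp: overring_def)
  ultimately show ?thesis by simp
qed

text \<open>
  The witness \<open>s\<close> is the constant coefficient of the orbit polynomial of \<open>u\<close>: it is invariant, it
  is divisible by \<open>u\<close>, and up to sign its inverse is a product of inverses of conjugates of \<open>u\<close>.
\<close>

lemma overring_eq_adjoin_inverse:
  assumes lf: "locally_finite_action G R"
    and u: "u \<in> carrier R - {\<zero>}" and Cu: "extended_overring T = adjoin_inverse R u"
  shows "\<exists>s\<in>carrier (fixed_ring R G) - {\<zero>}. T = adjoin_inverse (fixed_ring R G) s"
proof -
  have uc: "u \<in> carrier R" using u by simp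
  note C = extended_overring_overring
  have inv_u: "fraction R \<one> u \<in> extended_overring T"
    using adjoin_inverse_subset_iff[OF u C] Cu by simp
  have "finite {\<sigma> u | \<sigma>. \<sigma> \<in> G}" using lf uc by (simp add: locally_finite_action_def)
  then obtain ys where ys: "distinct ys" "set ys = {\<sigma> u | \<sigma>. \<sigma> \<in> G}"
    using finite_distinct_list by blast
  have conj: "y \<in> carrier R - {\<zero>} \<and> fraction R \<one> y \<in> extended_overring T"
    if y: "y \<in> set ys" for y
  proof -
    obtain \<sigma> where \<sigma>: "\<sigma> \<in> G" and y_eq: "y = \<sigma> u" using y unfolding ys(2) by blast
    interpret \<sigma>: domain_embedding R R \<sigma> by (rule aut_domain_embedding[OF \<sigma>])
    have "frac_map R \<sigma> (fraction R \<one> u) = fraction R \<one> y"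
      using \<sigma>.frac_map_fraction[OF one_closed u] y_eq by simp
    then show ?thesis
      using extended_overring_invariant[OF \<sigma> inv_u] \<sigma>.hom_nonzero[OF u] y_eq by simp
  qed
  define s where "s = root_poly R ys 0"
  have ysR: "set ys \<subseteq> carrier R - {\<zero>}"
    and inv_ys: "\<And>y. y \<in> set ys \<Longrightarrow> fraction R \<one> y \<in> extended_overring T"
    using conj by blast+
  have s0: "s \<noteq> \<zero>" and inv_s: "fraction R \<one> s \<in> extended_overring T"
    using inverse_root_poly_const[OF C ysR inv_ys] unfolding s_def by blast+
  have sA: "s \<in> carrier (fixed_ring R G) - {\<zero>}"
    using orbit_poly_fixed[OF uc ys, of 0] s0 unfolding s_def by blast
  then have sR: "s \<in> carrier R - {\<zero>}" using subringE(1)[OF fixed_ring_subring] by blast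
  obtain w where w: "w \<in> carrier R" "s = u \<otimes> w"
  proof -
    have "u \<in> set ys" unfolding ys(2) by (rule self_mem_orbit[OF uc])
    moreover have "set ys \<subseteq> carrier R" using ysR by blast
    ultimately show ?thesis using root_poly_const_dvd[of ys u] that unfolding s_def by blast
  qed
  note ov = adjoin_inverse_overring[OF sR]
  have sub: "subring (adjoin_inverse R s) (quotient_field R)"
    and R: "to_quotient_field R ` carrier R \<subseteq> adjoin_inverse R s"
    using ov by (auto simp: overring_def)
  \<comment> \<open>\<open>1/u = w/s\<close> shows \<open>R[1/u] \<subseteq> R[1/s]\<close>\<close>
  have "to_quotient_field R w \<in> adjoin_inverse R s" using R w(1) by blast
  moreover have "fraction R \<one> s \<in> adjoin_inverse R s"
    using adjoin_inverse_subset_iff[OF sR ov] by simp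
  ultimately have "to_quotient_field R w \<otimes>\<^bsub>quotient_field R\<^esub> fraction R \<one> s \<in> adjoin_inverse R s"
    by (rule subringE(6)[OF sub])
  moreover have "to_quotient_field R w \<otimes>\<^bsub>quotient_field R\<^esub> fraction R \<one> s = fraction R w s"
    using w(1) sR by (simp add: to_quotient_field_def fraction_mult)
  moreover have "w \<otimes> u = \<one> \<otimes> s" using w uc by (simp add: m_comm)
  then have "fraction R w s = fraction R \<one> u"
    using fraction_eq_iff[OF w(1) sR one_closed u] by simp
  ultimately have "fraction R \<one> u \<in> adjoin_inverse R s" by simp
  then have "extended_overring T \<subseteq> adjoin_inverse R s"
    unfolding Cu using adjoin_inverse_subset_iff[OF u ov] by simp
  then have "T \<subseteq> adjoin_inverse (fixed_ring R G) s"
    using fixed_fraction_mem_adjoin_inverse[OF _ sA] overring_subset_extended by blast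
  moreover have "adjoin_inverse (fixed_ring R G) s \<subseteq> T"
    using A.adjoin_inverse_subset_iff[OF _ T] inverse_mem_overring[OF lf sA inv_s] sA
    by (simp add: fixed_ring_simps)
  ultimately show ?thesis using sA by blast
qed

end

end

theorem corollary2p5p1:
  fixes R :: "('a, 'm) ring_scheme" and G :: "('a \<Rightarrow> 'a) set"
  assumes "domain R"
    and "subgroup G (ring_Aut R)"
    and "locally_finite_action G R"
    and "strong_G_domain R"
  shows "strong_G_domain (fixed_ring R G)"
proof -
  interpret domain_aut_action R G
    using assms(1,2) by (simp add: domain_aut_action_def domain_aut_action_axioms_def)
  have "\<exists>t\<in>carrier (fixed_ring R G) - {\<zero>\<^bsub>fixed_ring R G\<^esub>}. T = adjoin_inverse (fixed_ring R G) t"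
    if T: "overring (fixed_ring R G) T" for T
  proof -
    obtain u where "u \<in> carrier R - {\<zero>\<^bsub>R\<^esub>}" "extended_overring T = adjoin_inverse R u"
      using assms(4) extended_overring_overring[OF T] unfolding strong_G_domain_def by blast
    from overring_eq_adjoin_inverse[OF T assms(3) this] show ?thesis
      by (simp only: fixed_ring_simps)
  qed
  then show ?thesis
    unfolding strong_G_domain_def using fixed_ring_domain by blast
qed

end
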